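(* Let $\Psi$ be an integer-valued Gaussian free field on $\Lambda_n$ with Dirichlet boundary conditions and at inverse temperature $\beta^{-1}$. Then for any $\beta>0$, $$\mathbb P^{IV}_{\beta^{-1}}\left[\max_{v\in\Lambda_n}\Psi(v)\le\sqrt{\frac{\big(1-\frac{M(\beta)}{2}\big)2\beta}{\pi}}\;\log n\right]\longrightarrow1\qquad\text{as }n\to\infty .$$
   Context: $\Lambda_n$ with Dirichlet (zero) boundary conditions is the graph $([-n,n]^2\cap\mathbb Z^2)\cup\{\infty\}$ with nearest-neighbour edges and the vertices of $\partial[-n,n]^2$ connected to $\infty$ so that the graph is the planar dual of a square-grid box (one edge to $\infty$ for each non-corner boundary vertex, two parallel edges for each corner); marked vertex $v_0=\infty$; $V,E$ are its vertex and edge sets. Integer-valued Gaussian free field (IV-GFF) at inverse temperature $\beta^{-1}$: random $\Psi:V\to\mathbb Z$ with $\Psi(\infty)=0$ and $\mathbb P^{IV}_{\beta^{-1}}(\Psi)\propto\exp\big(-\frac1{2\beta}\sum_{\{x,y\}\in E}(\Psi(x)-\Psi(y))^2\big)$. Error function. An integer-valued Gaussian with parameters $(a,\beta)$ is a $\mathbb Z$-valued $X$ with $\mathbb P^{IG}_{\beta,a}[X=k]\propto e^{-\frac\beta2(k-a)^2}$; $\operatorname{Var}^{IG}(a,\beta)$ is its variance. $M(\beta):=(2\pi)^2\beta\inf_{a\in[0,1/2]}\operatorname{Var}^{IG}(a,(2\pi)^2\beta)$. *)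

theory Defs
  imports "HOL-Probability.Probability"
begin

text \<open>The law on the countable set S with mass function proportional to exp (- H). It is
  meaningful whenever S is nonempty and exp (- H) is summable on S; see
  pmf_gibbs_pmf, and pmf_int_gaussian and pmf_ivgff for the two laws used here.\<close>

definition gibbs_pmf :: "'a set \<Rightarrow> ('a \<Rightarrow> real) \<Rightarrow> 'a pmf" where
  "gibbs_pmf S H = embed_pmf (\<lambda>x. if x \<in> S then exp (- H x) / (\<Sum>\<^sub>\<infinity>y\<in>S. exp (- H y)) else 0)"

lemma pmf_gibbs_pmf:
  assumes ne: "S \<noteq> {}" and sm: "(\<lambda>x. exp (- H x)) summable_on S"
  shows "pmf (gibbs_pmf S H) x = (if x \<in> S then exp (- H x) / (\<Sum>\<^sub>\<infinity>y\<in>S. exp (- H y)) else 0)"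
proof -
  define Z where "Z = (\<Sum>\<^sub>\<infinity>y\<in>S. exp (- H y))"
  obtain s where s: "s \<in> S" using ne by auto
  have "exp (- H s) \<le> Z"
    using infsum_mono_neutral[of "\<lambda>x. exp (- H x)" "{s}" "\<lambda>x. exp (- H x)" S] sm s
    by (simp add: Z_def)
  then have Z: "Z > 0" by (meson exp_gt_zero less_le_trans)
  have ab: "Infinite_Set_Sum.abs_summable_on (\<lambda>x. exp (- H x)) S"
    using sm by (simp add: abs_summable_equivalent[symmetric])
  have "(\<integral>\<^sup>+x. ennreal (if x \<in> S then exp (- H x) / Z else 0) \<partial>count_space UNIV)
      = (\<integral>\<^sup>+x. ennreal (exp (- H x)) / ennreal Z * indicator S x \<partial>count_space UNIV)"
    using Z by (intro nn_integral_cong) (auto simp: divide_ennreal)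
  also have "\<dots> = (\<integral>\<^sup>+x. ennreal (exp (- H x)) / ennreal Z \<partial>count_space S)"
    by (simp add: nn_integral_count_space_indicator)
  also have "\<dots> = (\<integral>\<^sup>+x. ennreal (exp (- H x)) \<partial>count_space S) / ennreal Z"
    by (simp add: nn_integral_divide)
  also have "(\<integral>\<^sup>+x. ennreal (exp (- H x)) \<partial>count_space S) = ennreal Z"
    using nn_integral_conv_infsetsum[OF ab] infsetsum_infsum[OF ab] by (simp add: Z_def)
  also have "ennreal Z / ennreal Z = 1"
    using Z by (simp add: divide_ennreal)
  finally show ?thesis
    unfolding gibbs_pmf_def Z_def[symmetric]
    using Z by (subst pmf_embed_pmf) auto
qed

definition grid_box :: "nat \<Rightarrow> (int \<times> int) set" where
  "grid_box n = {- int n..int n} \<times> {- int n..int n}"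

definition box_boundary :: "nat \<Rightarrow> (int \<times> int) set" where
  "box_boundary n = {(x, y) \<in> grid_box n. \<bar>x\<bar> = int n \<or> \<bar>y\<bar> = int n}"

definition box_corners :: "nat \<Rightarrow> (int \<times> int) set" where
  "box_corners n = {- int n, int n} \<times> {- int n, int n}"

datatype vertex = Site "int \<times> int" | Infty

definition verts :: "nat \<Rightarrow> vertex set" where
  "verts n = insert Infty (Site ` grid_box n)"

text \<open>The edges form a multiset, each undirected edge being listed once, in an arbitrary
  orientation. Every corner lies both in box_boundary and in box_corners, and so is joined to
  Infty by two parallel edges. (This is the intended graph for n at least 1.)\<close>

definition edges :: "nat \<Rightarrow> (vertex \<times> vertex) multiset" where
  "edges n =
     mset_set {(Site (x, y), Site (x + 1, y)) | x y. (x, y) \<in> grid_box n \<and> (x + 1, y) \<in> grid_box n} +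
     mset_set {(Site (x, y), Site (x, y + 1)) | x y. (x, y) \<in> grid_box n \<and> (x, y + 1) \<in> grid_box n} +
     mset_set ((\<lambda>p. (Site p, Infty)) ` box_boundary n) +
     mset_set ((\<lambda>p. (Site p, Infty)) ` box_corners n)"

text \<open>Integer-valued functions on verts n vanishing at Infty; they are extended by 0 to all other
  elements of the type, so that each function on verts n is represented exactly once.\<close>

definition configs :: "nat \<Rightarrow> (vertex \<Rightarrow> int) set" where
  "configs n = {\<Psi>. \<Psi> Infty = 0 \<and> (\<forall>v. v \<notin> verts n \<longrightarrow> \<Psi> v = 0)}"

definition dirichlet_energy :: "nat \<Rightarrow> (vertex \<Rightarrow> int) \<Rightarrow> real" where
  "dirichlet_energy n \<Psi> = (\<Sum>(u, v)\<in>#edges n. (real_of_int (\<Psi> u - \<Psi> v))\<^sup>2)"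

text \<open>Here b is the inverse temperature.\<close>

definition ivgff :: "nat \<Rightarrow> real \<Rightarrow> (vertex \<Rightarrow> int) pmf" where
  "ivgff n b = gibbs_pmf (configs n) (\<lambda>\<Psi>. b / 2 * dirichlet_energy n \<Psi>)"

definition int_gaussian :: "real \<Rightarrow> real \<Rightarrow> int pmf" where
  "int_gaussian a \<beta> = gibbs_pmf UNIV (\<lambda>k. \<beta> / 2 * (real_of_int k - a)\<^sup>2)"

definition Var_IG :: "real \<Rightarrow> real \<Rightarrow> real" where
  "Var_IG a \<beta> = measure_pmf.variance (int_gaussian a \<beta>) real_of_int"

definition error_M :: "real \<Rightarrow> real" where
  "error_M \<beta> = (2 * pi)\<^sup>2 * \<beta> * (INF a\<in>{0..1/2}. Var_IG a ((2 * pi)\<^sup>2 * \<beta>))"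

lemma summable_on_exp_abs_int:
  assumes c: "c > 0"
  shows "(\<lambda>k::int. exp (- c * \<bar>real_of_int k\<bar>)) summable_on UNIV"
proof -
  have "summable (\<lambda>n. (exp (- c)) ^ n)" using c by (intro summable_geometric) auto
  then have g: "(\<lambda>n::nat. exp (- c * real n)) summable_on UNIV"
    by (intro norm_summable_imp_summable_on)
      (simp add: exp_of_nat_mult[symmetric] mult.commute)
  have U: "(UNIV :: int set) = range int \<union> range (\<lambda>n. - int n)"
    by (auto simp: image_iff) (metis int_cases2)
  have i: "inj (\<lambda>n. - int n)" by (auto intro: injI)
  have "(\<lambda>k::int. exp (- c * \<bar>real_of_int k\<bar>)) summable_on range int"
    using g by (subst summable_on_reindex) (auto simp: o_def)
  moreover have "(\<lambda>k::int. exp (- c * \<bar>real_of_int k\<bar>)) summable_on range (\<lambda>n. - int n)"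
    using g i by (subst summable_on_reindex) (auto simp: o_def)
  ultimately show ?thesis unfolding U by (rule summable_on_union)
qed

lemma summable_int_gaussian:
  assumes "\<beta> > 0"
  shows "(\<lambda>k::int. exp (- (\<beta> / 2 * (real_of_int k - a)\<^sup>2))) summable_on UNIV"
proof (rule summable_on_comparison_test)
  show "(\<lambda>k::int. exp (\<beta> / 2 * (\<bar>a\<bar> + 1)) * exp (- (\<beta> / 2) * \<bar>real_of_int k\<bar>)) summable_on UNIV"
    using assms by (intro summable_on_cmult_right summable_on_exp_abs_int) auto
next
  fix k :: int
  define u where "u = \<bar>real_of_int k - a\<bar>"
  have "0 \<le> (u - 1 / 2)\<^sup>2" by simp
  then have "u \<le> u\<^sup>2 + 1" by (simp add: power2_eq_square algebra_simps)
  then have "\<bar>real_of_int k\<bar> \<le> (real_of_int k - a)\<^sup>2 + \<bar>a\<bar> + 1"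
    by (simp add: u_def)
  then have "\<beta> / 2 * \<bar>real_of_int k\<bar> \<le> \<beta> / 2 * ((real_of_int k - a)\<^sup>2 + \<bar>a\<bar> + 1)"
    using assms by (intro mult_left_mono) auto
  then show "exp (- (\<beta> / 2 * (real_of_int k - a)\<^sup>2))
      \<le> exp (\<beta> / 2 * (\<bar>a\<bar> + 1)) * exp (- (\<beta> / 2) * \<bar>real_of_int k\<bar>)"
    by (simp add: exp_add[symmetric] algebra_simps)
qed auto

lemma pmf_int_gaussian:
  assumes "\<beta> > 0"
  shows "pmf (int_gaussian a \<beta>) k =
    exp (- (\<beta> / 2 * (real_of_int k - a)\<^sup>2)) / (\<Sum>\<^sub>\<infinity>j. exp (- (\<beta> / 2 * (real_of_int j - a)\<^sup>2)))"
  unfolding int_gaussian_def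
  using pmf_gibbs_pmf[OF UNIV_not_empty summable_int_gaussian[OF assms, of a]] by simp

lemma finite_grid_box [simp]: "finite (grid_box n)"
  by (simp add: grid_box_def)

lemma dirichlet_energy_ge_abs:
  assumes \<Psi>: "\<Psi> \<in> configs n" and p: "p \<in> grid_box n"
  shows "real_of_int \<bar>\<Psi> (Site p)\<bar> \<le> dirichlet_energy n \<Psi>"
proof -
  obtain x y where xy: "p = (x, y)" by (cases p)
  define g :: "vertex \<times> vertex \<Rightarrow> real" where "g = (\<lambda>(u, v). (real_of_int (\<Psi> u - \<Psi> v))\<^sup>2)"
  define H where "H = {(Site (x, y), Site (x + 1, y)) | x y. (x, y) \<in> grid_box n \<and> (x + 1, y) \<in> grid_box n}"
  define V where "V = {(Site (x, y), Site (x, y + 1)) | x y. (x, y) \<in> grid_box n \<and> (x, y + 1) \<in> grid_box n}"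
  define B where "B = (\<lambda>p. (Site p, Infty)) ` box_boundary n"
  define C where "C = (\<lambda>p. (Site p, Infty)) ` box_corners n"
  have g0: "g e \<ge> 0" for e by (cases e) (simp add: g_def)
  have finH: "finite H"
    by (rule finite_subset[of _ "(Site ` grid_box n) \<times> (Site ` grid_box n)"]) (auto simp: H_def)
  have finB: "finite B"
    by (rule finite_subset[of _ "(\<lambda>p. (Site p, Infty)) ` grid_box n"])
      (auto simp: B_def box_boundary_def)
  have E: "dirichlet_energy n \<Psi> = sum g H + sum g V + sum g B + sum g C"
    unfolding dirichlet_energy_def edges_def H_def V_def B_def C_def g_def
    by (simp add: sum_unfold_sum_mset)
  have int_sq: "real_of_int \<bar>k\<bar> \<le> (real_of_int k)\<^sup>2" for k :: int
  proof -
    have "\<bar>k\<bar> * 1 \<le> \<bar>k\<bar> * \<bar>k\<bar>"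
    proof (cases "k = 0")
      case False
      then show ?thesis by (intro mult_left_mono) auto
    qed simp
    then have "\<bar>k\<bar> \<le> k\<^sup>2" by (simp add: power2_eq_square)
    then show ?thesis by (metis of_int_le_iff of_int_power)
  qed
  define h where "h i = (Site (i, y), Site (i + 1, y))" for i
  have step: "real_of_int \<bar>\<Psi> (Site (int n - int m, y))\<bar>
      \<le> real_of_int \<bar>\<Psi> (Site (int n, y))\<bar> + (\<Sum>i\<in>{int n - int m..<int n}. g (h i))" for m
  proof (induction m)
    case (Suc m)
    define j where "j = int n - int (Suc m)"
    have j1: "int n - int m = j + 1" by (simp add: j_def)
    have I: "{j..<int n} = insert j {j + 1..<int n}" by (auto simp: j_def)
    have "real_of_int \<bar>\<Psi> (Site (j, y))\<bar>
        \<le> real_of_int \<bar>\<Psi> (Site (j + 1, y))\<bar> + real_of_int \<bar>\<Psi> (Site (j, y)) - \<Psi> (Site (j + 1, y))\<bar>"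
      by linarith
    also have "real_of_int \<bar>\<Psi> (Site (j, y)) - \<Psi> (Site (j + 1, y))\<bar> \<le> g (h j)"
      using int_sq[of "\<Psi> (Site (j, y)) - \<Psi> (Site (j + 1, y))"] by (simp add: g_def h_def)
    finally show ?case using Suc unfolding j1 j_def[symmetric] I by simp
  qed simp
  have x: "- int n \<le> x" "x \<le> int n" "- int n \<le> y" "y \<le> int n"
    using p by (auto simp: xy grid_box_def)
  have "real_of_int \<bar>\<Psi> (Site p)\<bar>
      \<le> real_of_int \<bar>\<Psi> (Site (int n, y))\<bar> + (\<Sum>i\<in>{x..<int n}. g (h i))"
    using step[of "nat (int n - x)"] x by (simp add: xy)
  also have "(\<Sum>i\<in>{x..<int n}. g (h i)) = sum g (h ` {x..<int n})"
    by (subst sum.reindex) (auto simp: inj_on_def h_def)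
  also have "\<dots> \<le> sum g H"
    using x by (intro sum_mono2 finH) (auto simp: H_def h_def grid_box_def g0)
  also have "real_of_int \<bar>\<Psi> (Site (int n, y))\<bar> \<le> g (Site (int n, y), Infty)"
    using \<Psi> int_sq by (simp add: g_def configs_def)
  also have "\<dots> \<le> sum g B"
    using x by (intro member_le_sum finB g0) (auto simp: B_def box_boundary_def grid_box_def)
  finally show ?thesis
    using sum_nonneg[of V g] sum_nonneg[of C g] g0 unfolding E by simp
qed

lemma summable_ivgff:
  assumes b: "b > 0"
  shows "(\<lambda>\<Psi>. exp (- (b / 2 * dirichlet_energy n \<Psi>))) summable_on configs n"
proof -
  define A where "A = Site ` grid_box n"
  define N where "N = real (card A)"
  define c where "c = b / 2 / N"
  have finA: "finite A" by (simp add: A_def)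
  have neA: "A \<noteq> {}" by (auto simp: A_def grid_box_def)
  have N: "N > 0" using finA neA by (simp add: N_def card_gt_0_iff)
  have c: "c > 0" using b N by (simp add: c_def)
  define W :: "(vertex \<Rightarrow> int) \<Rightarrow> real"
    where "W = (\<lambda>f. \<Prod>v\<in>A. exp (- c * \<bar>real_of_int (f v)\<bar>))"
  have s1: "Infinite_Set_Sum.abs_summable_on (\<lambda>k::int. exp (- c * \<bar>real_of_int k\<bar>)) UNIV"
    unfolding abs_summable_equivalent[symmetric] using summable_on_exp_abs_int[OF c] by simp
  have "Infinite_Set_Sum.abs_summable_on W (PiE A (\<lambda>_. UNIV))"
    unfolding W_def by (rule abs_summable_on_prod_PiE[OF finA]) (simp, rule s1)
  then have W: "W summable_on PiE A (\<lambda>_. UNIV)"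
    unfolding abs_summable_equivalent[symmetric] by (rule abs_summable_summable)
  have inj: "inj_on (\<lambda>f. restrict f A) (configs n)"
  proof (rule inj_onI, rule ext)
    fix f g v assume fg: "f \<in> configs n" "g \<in> configs n" "restrict f A = restrict g A"
    show "f v = g v"
    proof (cases "v \<in> A")
      case True then show ?thesis using fg(3) by (metis restrict_apply')
    next
      case False
      then have "v = Infty \<or> v \<notin> verts n" by (auto simp: verts_def A_def)
      then show ?thesis using fg by (auto simp: configs_def)
    qed
  qed
  have "W summable_on (\<lambda>f. restrict f A) ` configs n"
    by (rule summable_on_subset_banach[OF W]) auto
  then have "(W \<circ> (\<lambda>f. restrict f A)) summable_on configs n"
    using summable_on_reindex[OF inj] by blast
  moreover have "W \<circ> (\<lambda>f. restrict f A) = W"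
    by (auto simp: W_def fun_eq_iff intro!: prod.cong)
  ultimately have W': "W summable_on configs n" by simp
  show ?thesis
  proof (rule summable_on_comparison_test[OF W'])
    fix \<Psi> assume \<Psi>: "\<Psi> \<in> configs n"
    have "(\<Sum>v\<in>A. \<bar>real_of_int (\<Psi> v)\<bar>) \<le> (\<Sum>v\<in>A. dirichlet_energy n \<Psi>)"
      using dirichlet_energy_ge_abs[OF \<Psi>] by (intro sum_mono) (auto simp: A_def)
    also have "\<dots> = N * dirichlet_energy n \<Psi>" by (simp add: N_def)
    finally have "c * (\<Sum>v\<in>A. \<bar>real_of_int (\<Psi> v)\<bar>) \<le> c * (N * dirichlet_energy n \<Psi>)"
      using c by (intro mult_left_mono) auto
    also have "\<dots> = b / 2 * dirichlet_energy n \<Psi>" using N by (simp add: c_def)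
    finally show "exp (- (b / 2 * dirichlet_energy n \<Psi>)) \<le> W \<Psi>"
      by (simp add: W_def exp_sum[OF finA, symmetric] sum_negf sum_distrib_left[symmetric])
  qed simp
qed

lemma pmf_ivgff:
  assumes "b > 0"
  shows "pmf (ivgff n b) \<Psi> =
    (if \<Psi> \<in> configs n
     then exp (- (b / 2 * dirichlet_energy n \<Psi>)) /
       (\<Sum>\<^sub>\<infinity>\<Phi>\<in>configs n. exp (- (b / 2 * dirichlet_energy n \<Phi>)))
     else 0)"
proof -
  have "(\<lambda>_. 0) \<in> configs n" by (simp add: configs_def)
  then have "configs n \<noteq> {}" by blast
  then show ?thesis
    unfolding ivgff_def by (rule pmf_gibbs_pmf) (rule summable_ivgff[OF assms])
qed

end

theory Submission
  imports Defs "HOL-Real_Asymp.Real_Asymp"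
begin

text \<open>Chernoff's bound and a union bound over the sites reduce the claim to an estimate of
  the exponential moment of the height at a site v. Write the height at v as the pairing of the
  gradient with a unit flow from v to infinity; completing the square edge by edge turns the moment
  into the Gaussian factor exp (beta t^2/2 * sum of the squared flow) times a ratio T(s) / T(0), where T(s) is
  the partition function with every edge gradient shifted by s = beta * t * flow.

  Each edge weight is the Fourier transform of a centred Gaussian variable X. Conditioned on X
  modulo 2 pi, the integer part of X is an integer-valued Gaussian, and the modulus of its characteristic
  function is at most exp (- Var / 2 * (2 pi s)^2 + O(|s|^3)). Gradients of heights are
  integers, so apart from its phase e^(- i s X) the shifted sum only sees X modulo 2 pi, and by positive
  definiteness T(s) / T(0) is at most the product over the edges of these bounds. This gains the factor 1 - M in the variance, which beats 1 - M / 2, and the slack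
  absorbs the bounded error terms.

  The flow need not be the electrical one: through each edge send the angle which its dual edge
  subtends at v, divided by 2 pi. It is exactly divergence free away from v, the sum of its squares is at most
  log n / (2 pi) + O(1), and the sum of its cubes is bounded.\<close>

section \<open>Integer-valued Gaussians\<close>

text \<open>The edge gradients come from one height function, so a bound for a single edge factor
  cannot simply be multiplied over the edges. The comparison is therefore strengthened to hermitian
  forms with arbitrary complex coefficients, a statement that survives multiplication by one more
  edge factor. Its price is a sum over pairs of heights, which an averaging argument over large
  boxes turns back into a single sum. Conditioning modulo 2 pi leaves the centre of the integer
  Gaussian uncontrolled, which is why M contains an infimum over centres; integer shifts and
  reflection reduce them to [0, 1/2]. The tilt t does not depend on n. It is tuned to the variance
  factor 1 - M/2, for which the Chernoff bound would be of order n^-2, just matching the roughly 4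
  n^2 sites. The factor 1 - M actually obtained adds a power n^(-M/(1 - M/2)), so the strict
  positivity of M decides the matter. The constant 1/(2 pi) in the energy of the angle flow is that
  of the lattice Green function at the centre of a box, so the explicit flow loses nothing to
  leading order.\<close>

lemma integrable_measure_pmf_summable:
  fixes f :: "'a \<Rightarrow> real"
  assumes "(\<lambda>x. pmf p x * f x) summable_on UNIV"
  shows "integrable (measure_pmf p) f"
proof -
  have "Infinite_Set_Sum.abs_summable_on (\<lambda>x. pmf p x *\<^sub>R f x) UNIV"
    using assms unfolding abs_summable_equivalent[symmetric]
    using summable_on_iff_abs_summable_on_real by force
  then show ?thesis
    unfolding measure_pmf_eq_density Infinite_Set_Sum.abs_summable_on_def
    by (subst integrable_density) auto
qed

lemma integral_measure_pmf_infsum: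
  fixes f :: "'a \<Rightarrow> 'b::{banach, second_countable_topology}"
  assumes "integrable (measure_pmf p) f"
  shows "measure_pmf.expectation p f = (\<Sum>\<^sub>\<infinity>x. pmf p x *\<^sub>R f x)"
proof -
  have *: "integrable (count_space UNIV) (\<lambda>x. pmf p x *\<^sub>R f x)"
    using assms unfolding measure_pmf_eq_density by (subst (asm) integrable_density) auto
  then have "Infinite_Set_Sum.abs_summable_on (\<lambda>x. pmf p x *\<^sub>R f x) UNIV"
    by (simp add: Infinite_Set_Sum.abs_summable_on_def)
  from infsetsum_infsum[OF this] show ?thesis
    unfolding measure_pmf_eq_density infsetsum_def
    by (subst integral_density) auto
qed

lemma int_gaussian_weight_le:
  assumes "B > 0" "\<bar>a\<bar> \<le> (1::real)"
  shows "exp (- (B / 2 * (real_of_int k - a)\<^sup>2)) \<le> exp B * exp (- (B / 2) * \<bar>real_of_int k\<bar>)"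
proof -
  define u where "u = \<bar>real_of_int k - a\<bar>"
  have "0 \<le> (u - 1 / 2)\<^sup>2" by simp
  then have "u \<le> u\<^sup>2 + 1" by (simp add: power2_eq_square algebra_simps)
  moreover have "u\<^sup>2 = (real_of_int k - a)\<^sup>2" by (simp add: u_def)
  moreover have "\<bar>real_of_int k\<bar> \<le> u + 1" using assms by (auto simp: u_def)
  ultimately have "\<bar>real_of_int k\<bar> \<le> (real_of_int k - a)\<^sup>2 + 2" by linarith
  then have "B / 2 * \<bar>real_of_int k\<bar> \<le> B / 2 * ((real_of_int k - a)\<^sup>2 + 2)"
    using assms by (intro mult_left_mono) auto
  then show ?thesis
    by (simp add: exp_add[symmetric] algebra_simps)
qed

lemma int_gaussian_partition_bounds:
  assumes B: "B > 0"
  obtains Zl Zu :: real where "Zl > 0" "Zu > 0"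
    "\<And>a. a \<in> {0..1/2} \<Longrightarrow> Zl \<le> (\<Sum>\<^sub>\<infinity>j::int. exp (- (B / 2 * (real_of_int j - a)\<^sup>2)))"
    "\<And>a. a \<in> {0..1/2} \<Longrightarrow> (\<Sum>\<^sub>\<infinity>j::int. exp (- (B / 2 * (real_of_int j - a)\<^sup>2))) \<le> Zu"
proof
  show "exp (- B / 8) > 0" by simp
  have sm: "(\<lambda>k::int. exp B * exp (- (B / 2) * \<bar>real_of_int k\<bar>)) summable_on UNIV"
    using B by (intro summable_on_cmult_right summable_on_exp_abs_int) auto
  define U where "U = (\<Sum>\<^sub>\<infinity>k::int. exp B * exp (- (B / 2) * \<bar>real_of_int k\<bar>))"
  have "exp B \<le> U"
    using infsum_mono_neutral[of "\<lambda>k::int. exp B * exp (- (B / 2) * \<bar>real_of_int k\<bar>)" "{0}"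
      "\<lambda>k::int. exp B * exp (- (B / 2) * \<bar>real_of_int k\<bar>)" UNIV] sm
    by (simp add: U_def)
  then show "U > 0" by (meson exp_gt_zero less_le_trans)
  fix a :: real assume a: "a \<in> {0..1/2}"
  show "(\<Sum>\<^sub>\<infinity>j::int. exp (- (B / 2 * (real_of_int j - a)\<^sup>2))) \<le> U"
    unfolding U_def using a
    by (intro infsum_mono summable_int_gaussian B sm int_gaussian_weight_le) auto
  have "a\<^sup>2 \<le> (1/2)\<^sup>2" using a by (intro power_mono) auto
  then have "B * a\<^sup>2 \<le> B * (1/4)" using B by (intro mult_left_mono) (auto simp: power2_eq_square)
  then have "exp (- B / 8) \<le> exp (- (B / 2 * (real_of_int 0 - a)\<^sup>2))" by simp
  also have "\<dots> \<le> (\<Sum>\<^sub>\<infinity>j::int. exp (- (B / 2 * (real_of_int j - a)\<^sup>2)))"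
    using infsum_mono_neutral[of "\<lambda>k::int. exp (- (B / 2 * (real_of_int k - a)\<^sup>2))" "{0}"
      "\<lambda>k::int. exp (- (B / 2 * (real_of_int k - a)\<^sup>2))" UNIV] summable_int_gaussian[OF B, of a]
    by simp
  finally show "exp (- B / 8) \<le> \<dots>" .
qed

text \<open>The rate \<open>B / 4\<close> is half the decay rate \<open>B / 2\<close> of the
  majorant of the weights, so a summable tail with rate \<open>B / 4\<close> is left over, uniformly
  in \<open>a\<close>.\<close>

lemma int_gaussian_exp_moment:
  assumes B: "B > 0"
  obtains K where "K > 0"
    "\<And>a. a \<in> {0..1/2} \<Longrightarrow> integrable (int_gaussian a B) (\<lambda>k. exp (B / 4 * \<bar>real_of_int k\<bar>))"
    "\<And>a. a \<in> {0..1/2} \<Longrightarrow> measure_pmf.expectation (int_gaussian a B) (\<lambda>k. exp (B / 4 * \<bar>real_of_int k\<bar>)) \<le> K"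
proof -
  obtain Zl Zu :: real where Z: "Zl > 0" "Zu > 0"
    "\<And>a. a \<in> {0..1/2} \<Longrightarrow> Zl \<le> (\<Sum>\<^sub>\<infinity>j::int. exp (- (B / 2 * (real_of_int j - a)\<^sup>2)))"
    "\<And>a. a \<in> {0..1/2} \<Longrightarrow> (\<Sum>\<^sub>\<infinity>j::int. exp (- (B / 2 * (real_of_int j - a)\<^sup>2))) \<le> Zu"
    using int_gaussian_partition_bounds[OF B] by blast
  define f where "f k = exp B / Zl * exp (- (B / 4) * \<bar>real_of_int k\<bar>)" for k
  have sf: "f summable_on UNIV"
    unfolding f_def using B by (intro summable_on_cmult_right summable_on_exp_abs_int) auto
  have f0: "f k \<ge> 0" for k using Z by (simp add: f_def)
  have le: "pmf (int_gaussian a B) k * exp (B / 4 * \<bar>real_of_int k\<bar>) \<le> f k"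
    if a: "a \<in> {0..1/2}" for a k
  proof -
    have "pmf (int_gaussian a B) k
        \<le> (exp B * exp (- (B / 2) * \<bar>real_of_int k\<bar>)) / Zl"
      unfolding pmf_int_gaussian[OF B]
      using Z(3)[OF a] Z(1) a by (intro frac_le int_gaussian_weight_le[OF B]) auto
    then have "pmf (int_gaussian a B) k * exp (B / 4 * \<bar>real_of_int k\<bar>)
      \<le> (exp B * exp (- (B / 2) * \<bar>real_of_int k\<bar>)) / Zl * exp (B / 4 * \<bar>real_of_int k\<bar>)"
      by (intro mult_right_mono) auto
    also have "\<dots> = f k"
    proof -
      have "exp (- (B / 2) * \<bar>real_of_int k\<bar>) * exp (B / 4 * \<bar>real_of_int k\<bar>) = exp (- (B / 4) * \<bar>real_of_int k\<bar>)"
        unfolding exp_add[symmetric] by (simp add: algebra_simps)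
      then show ?thesis by (simp add: f_def)
    qed
    finally show ?thesis .
  qed
  have sm: "(\<lambda>k. pmf (int_gaussian a B) k * exp (B / 4 * \<bar>real_of_int k\<bar>)) summable_on UNIV"
    if a: "a \<in> {0..1/2}" for a
    by (rule summable_on_comparison_test[OF sf]) (use le[OF a] in auto)
  show ?thesis
  proof
    show "infsum f UNIV + 1 > 0" using infsum_nonneg[of UNIV f] f0 by (simp add: add_nonneg_pos)
    fix a :: real assume a: "a \<in> {0..1/2}"
    show i: "integrable (int_gaussian a B) (\<lambda>k. exp (B / 4 * \<bar>real_of_int k\<bar>))"
      using sm[OF a] by (rule integrable_measure_pmf_summable)
    have "measure_pmf.expectation (int_gaussian a B) (\<lambda>k. exp (B / 4 * \<bar>real_of_int k\<bar>)) \<le> infsum f UNIV"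
      unfolding integral_measure_pmf_infsum[OF i] using le[OF a] sm[OF a] sf
      by (intro infsum_mono) auto
    then show "measure_pmf.expectation (int_gaussian a B) (\<lambda>k. exp (B / 4 * \<bar>real_of_int k\<bar>)) \<le> infsum f UNIV + 1"
      by simp
  qed
qed

lemma power_le_fact_exp:
  assumes "(x::real) \<ge> 0"
  shows "x ^ n \<le> fact n * exp x"
proof -
  have s: "(\<lambda>k. x ^ k /\<^sub>R fact k) sums exp x" by (rule exp_converges)
  have "(\<Sum>k\<in>{n}. x ^ k /\<^sub>R fact k) \<le> (\<Sum>k. x ^ k /\<^sub>R fact k)"
    by (rule sum_le_suminf[OF sums_summable[OF s]]) (simp_all add: assms)
  then have "x ^ n / fact n \<le> exp x"
    unfolding sums_unique[OF s, symmetric] by (simp add: divide_inverse mult.commute)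
  then show ?thesis by (simp add: pos_divide_le_eq mult.commute)
qed

text \<open>Powers are dominated by the exponential moment. Order 3 is what a quadratic Taylor
  expansion needs for its remainder, and \<open>C\<close> must not depend on the centre.\<close>

lemma int_gaussian_central_moments:
  assumes B: "B > 0"
  obtains C where "C > 0"
    "\<And>a. a \<in> {0..1/2} \<Longrightarrow> integrable (int_gaussian a B) real_of_int"
    "\<And>a m n. a \<in> {0..1/2} \<Longrightarrow> integrable (int_gaussian a B) (\<lambda>k. \<bar>real_of_int k - m\<bar> ^ n)"
    "\<And>a n. a \<in> {0..1/2} \<Longrightarrow> n \<le> 3 \<Longrightarrow>
      measure_pmf.expectation (int_gaussian a B)
        (\<lambda>k. \<bar>real_of_int k - measure_pmf.expectation (int_gaussian a B) real_of_int\<bar> ^ n) \<le> C"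
proof -
  define c where "c = B / 4"
  have c: "c > 0" using B by (simp add: c_def)
  obtain K where K: "K > 0"
    "\<And>a. a \<in> {0..1/2} \<Longrightarrow> integrable (int_gaussian a B) (\<lambda>k. exp (c * \<bar>real_of_int k\<bar>))"
    "\<And>a. a \<in> {0..1/2} \<Longrightarrow> measure_pmf.expectation (int_gaussian a B) (\<lambda>k. exp (c * \<bar>real_of_int k\<bar>)) \<le> K"
    using int_gaussian_exp_moment[OF B] unfolding c_def by metis
  have le: "\<bar>real_of_int k - m\<bar> ^ n \<le> fact n / c ^ n * exp (c * \<bar>m\<bar>) * exp (c * \<bar>real_of_int k\<bar>)" for k m n
  proof -
    have "(c * \<bar>real_of_int k - m\<bar>) ^ n \<le> fact n * exp (c * \<bar>real_of_int k - m\<bar>)"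
      using c by (intro power_le_fact_exp) auto
    also have "exp (c * \<bar>real_of_int k - m\<bar>) \<le> exp (c * \<bar>m\<bar> + c * \<bar>real_of_int k\<bar>)"
      using c by (simp flip: distrib_left)
    finally show ?thesis using c by (simp add: power_mult_distrib field_simps exp_add)
  qed
  have int: "integrable (int_gaussian a B) (\<lambda>k. \<bar>real_of_int k - m\<bar> ^ n)" if a: "a \<in> {0..1/2}" for a m n
    by (rule Bochner_Integration.integrable_bound[OF integrable_mult_right[OF K(2)[OF a]], of _ "fact n / c ^ n * exp (c * \<bar>m\<bar>)"])
      (use le c in auto)
  have int1: "integrable (int_gaussian a B) real_of_int" if a: "a \<in> {0..1/2}" for a
    using int[OF a, of 0 1] integrable_norm_iff[of real_of_int "int_gaussian a B"] by simp
  have ex: "measure_pmf.expectation (int_gaussian a B) (\<lambda>k. \<bar>real_of_int k - m\<bar> ^ n) \<le> fact n / c ^ n * exp (c * \<bar>m\<bar>) * K"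
    if a: "a \<in> {0..1/2}" for a m n
  proof -
    have "measure_pmf.expectation (int_gaussian a B) (\<lambda>k. \<bar>real_of_int k - m\<bar> ^ n)
      \<le> measure_pmf.expectation (int_gaussian a B) (\<lambda>k. fact n / c ^ n * exp (c * \<bar>m\<bar>) * exp (c * \<bar>real_of_int k\<bar>))"
      by (intro integral_mono int[OF a] integrable_mult_right K(2)[OF a] le)
    also have "\<dots> = fact n / c ^ n * exp (c * \<bar>m\<bar>) * measure_pmf.expectation (int_gaussian a B) (\<lambda>k. exp (c * \<bar>real_of_int k\<bar>))"
      by simp
    also have "\<dots> \<le> fact n / c ^ n * exp (c * \<bar>m\<bar>) * K"
      using c by (intro mult_left_mono K(3)[OF a]) auto
    finally show ?thesis .
  qed
  define C where "C = (\<Sum>n\<le>3. fact n / c ^ n * exp K * K)"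
  show ?thesis
  proof
    have pos: "fact n / c ^ n * exp K * K > 0" for n using c K(1) by simp
    then show "C > 0" unfolding C_def by (intro sum_pos) auto
    show "integrable (int_gaussian a B) real_of_int" if "a \<in> {0..1/2}" for a using int1[OF that] .
    show "integrable (int_gaussian a B) (\<lambda>k. \<bar>real_of_int k - m\<bar> ^ n)" if "a \<in> {0..1/2}" for a m n
      using int[OF that] .
    fix a :: real and n :: nat assume a: "a \<in> {0..1/2}" and n: "n \<le> 3"
    define \<mu> where "\<mu> = measure_pmf.expectation (int_gaussian a B) real_of_int"
    \<comment> \<open>The case \<open>m = 0\<close>, \<open>n = 1\<close> bounds the mean, which
      replaces the factor \<open>exp (c * \<bar>\<mu>\<bar>)\<close> by the uniform
      \<open>exp K\<close>.\<close>
    have "\<bar>\<mu>\<bar> \<le> measure_pmf.expectation (int_gaussian a B) (\<lambda>k. \<bar>real_of_int k\<bar>)"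
      unfolding \<mu>_def using integral_norm_bound[of "int_gaussian a B" real_of_int] by simp
    also have "\<dots> \<le> K / c" using ex[OF a, of 0 1] by simp
    finally have "c * \<bar>\<mu>\<bar> \<le> K" using c by (simp add: field_simps)
    then have "fact n / c ^ n * exp (c * \<bar>\<mu>\<bar>) * K \<le> fact n / c ^ n * exp K * K"
      using c K(1) by (intro mult_right_mono mult_left_mono) auto
    also have "\<dots> \<le> C" unfolding C_def
      using n pos by (intro member_le_sum) (auto intro: less_imp_le)
    finally show "measure_pmf.expectation (int_gaussian a B) (\<lambda>k. \<bar>real_of_int k - \<mu>\<bar> ^ n) \<le> C"
      using ex[OF a, of \<mu> n] by simp
  qed
qed

section \<open>Minimal variance and decay of characteristic functions\<close>

definition min_var :: "real \<Rightarrow> real" where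
  "min_var B = (INF a\<in>{0..1/2}. Var_IG a B)"

lemma Var_IG_nonneg: "Var_IG a B \<ge> 0"
  unfolding Var_IG_def by (rule Bochner_Integration.integral_nonneg) simp

lemma min_var_le: "a \<in> {0..1/2} \<Longrightarrow> min_var B \<le> Var_IG a B"
  unfolding min_var_def by (intro cINF_lower bdd_belowI2[where m = 0] Var_IG_nonneg)

text \<open>Both 0 and 1 carry mass at least \<open>q\<close>, uniformly in \<open>a\<close>, and no
  mean is close to both of them.\<close>

lemma min_var_pos:
  assumes B: "B > 0"
  shows "min_var B > 0"
proof -
  obtain Zl Zu :: real where Z: "Zl > 0" "Zu > 0"
    "\<And>a. a \<in> {0..1/2} \<Longrightarrow> Zl \<le> (\<Sum>\<^sub>\<infinity>j::int. exp (- (B / 2 * (real_of_int j - a)\<^sup>2)))"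
    "\<And>a. a \<in> {0..1/2} \<Longrightarrow> (\<Sum>\<^sub>\<infinity>j::int. exp (- (B / 2 * (real_of_int j - a)\<^sup>2))) \<le> Zu"
    using int_gaussian_partition_bounds[OF B] by blast
  obtain C where C:
    "\<And>a m n. a \<in> {0..1/2} \<Longrightarrow> integrable (int_gaussian a B) (\<lambda>k. \<bar>real_of_int k - m\<bar> ^ n)"
    using int_gaussian_central_moments[OF B] by metis
  define q where "q = exp (- B / 2) / Zu"
  have q: "q > 0" using Z by (simp add: q_def)
  have p: "q \<le> pmf (int_gaussian a B) k" if a: "a \<in> {0..1/2}" and k: "k \<in> {0, 1}" for a k
  proof -
    have "\<bar>real_of_int k - a\<bar> \<le> 1" using a k by auto
    then have "(real_of_int k - a)\<^sup>2 \<le> 1" by (simp add: abs_square_le_1)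
    then have "B * (real_of_int k - a)\<^sup>2 \<le> B * 1" using B by (intro mult_left_mono) auto
    then show ?thesis unfolding q_def pmf_int_gaussian[OF B]
      using Z(3,4)[OF a] Z(1) by (intro frac_le) auto
  qed
  have "q / 2 \<le> Var_IG a B" if a: "a \<in> {0..1/2}" for a
  proof -
    define \<mu> where "\<mu> = measure_pmf.expectation (int_gaussian a B) real_of_int"
    define g where "g k = (real_of_int k - \<mu>)\<^sup>2" for k
    have g: "integrable (int_gaussian a B) g" using C[OF a, of \<mu> 2] by (simp add: g_def[abs_def])
    have m0: "measure_pmf.expectation (int_gaussian a B) (\<lambda>k. indicator {0, 1} k * g k) \<le>
       measure_pmf.expectation (int_gaussian a B) g"
    proof (rule integral_mono[OF _ g])
      show "integrable (int_gaussian a B) (\<lambda>k. indicator {0, 1} k * g k)"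
        by (rule Bochner_Integration.integrable_bound[OF g]) (simp_all add: indicator_def)
    qed (simp add: g_def indicator_def)
    have "measure_pmf.expectation (int_gaussian a B) (\<lambda>k. indicator {0, 1} k * g k)
      = (\<Sum>k\<in>{0,1}. pmf (int_gaussian a B) k *\<^sub>R (indicator {0, 1} k * g k))"
      by (rule integral_measure_pmf) (auto simp: indicator_def)
    also have "\<dots> = pmf (int_gaussian a B) 0 * g 0 + pmf (int_gaussian a B) 1 * g 1" by simp
    also have "\<dots> \<ge> q * g 0 + q * g 1"
      using p[OF a] by (intro add_mono mult_right_mono) (auto simp: g_def)
    finally have "q * (g 0 + g 1) \<le> Var_IG a B"
      using m0 by (simp add: Var_IG_def \<mu>_def g_def[abs_def] distrib_left)
    moreover have "0 \<le> (2 * \<mu> - 1)\<^sup>2" by simp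
    then have "g 0 + g 1 \<ge> 1/2" by (simp add: g_def power2_eq_square algebra_simps)
    then have "q * (g 0 + g 1) \<ge> q * (1/2)" using q by (intro mult_left_mono) auto
    ultimately show ?thesis by simp
  qed
  then have "q / 2 \<le> min_var B" unfolding min_var_def by (intro cINF_greatest) auto
  then show ?thesis using q by linarith
qed

lemma iexp_approx_quadratic:
  "cmod (iexp x - (1 + \<i> * complex_of_real x - complex_of_real (x\<^sup>2 / 2))) \<le> \<bar>x\<bar> ^ 3 / 6"
proof -
  have "{..2::nat} = {0, 1, 2}" by auto
  then have "(\<Sum>k\<le>2. (\<i> * complex_of_real x) ^ k / fact k) = 1 + \<i> * complex_of_real x - complex_of_real (x\<^sup>2 / 2)"
    by (simp add: power_mult_distrib)
  moreover have "Suc 2 = 3" "fact 3 = (6::real)" by (simp_all add: fact_numeral)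
  ultimately show ?thesis using iexp_approx1[of x 2] by (simp only: )
qed

text \<open>Centring at the mean costs only a phase and removes the linear term; the quadratic
  Taylor polynomial then has expectation \<open>1 - \<sigma>\<^sup>2 * V / 2\<close>, with a cubic
  remainder. The cubic correction also makes the bound valid for large \<sigma>.\<close>

lemma int_gaussian_char_le:
  assumes B: "B > 0"
  obtains C where "C > 0"
    "\<And>a \<sigma>. a \<in> {0..1/2} \<Longrightarrow> norm (measure_pmf.expectation (int_gaussian a B) (\<lambda>k. cis (\<sigma> * real_of_int k)))
      \<le> exp (- (min_var B * \<sigma>\<^sup>2 / 2) + C * \<bar>\<sigma>\<bar> ^ 3)"
proof -
  obtain C where C: "C > 0"
    "\<And>a. a \<in> {0..1/2} \<Longrightarrow> integrable (int_gaussian a B) real_of_int"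
    "\<And>a m n. a \<in> {0..1/2} \<Longrightarrow> integrable (int_gaussian a B) (\<lambda>k. \<bar>real_of_int k - m\<bar> ^ n)"
    "\<And>a n. a \<in> {0..1/2} \<Longrightarrow> n \<le> 3 \<Longrightarrow>
      measure_pmf.expectation (int_gaussian a B)
        (\<lambda>k. \<bar>real_of_int k - measure_pmf.expectation (int_gaussian a B) real_of_int\<bar> ^ n) \<le> C"
    using int_gaussian_central_moments[OF B] by metis
  define v where "v = min_var B"
  have v: "v > 0" using min_var_pos[OF B] by (simp add: v_def)
  \<comment> \<open>The first summand pays for the Taylor remainder, the second for the range of
    \<sigma> in which the Taylor polynomial is negative.\<close>
  define C' where "C' = C / 6 + v / (2 * sqrt (2 / C))"
  show ?thesis
  proof
    show C'0: "C' > 0" using C(1) v by (simp add: C'_def add_pos_pos)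
    fix a \<sigma> :: real assume a: "a \<in> {0..1/2}"
    let ?E = "measure_pmf.expectation (int_gaussian a B)"
    define \<mu> where "\<mu> = ?E real_of_int"
    define V where "V = ?E (\<lambda>k. (real_of_int k - \<mu>)\<^sup>2)"
    have V: "V = Var_IG a B" by (simp add: V_def \<mu>_def Var_IG_def)
    have vV: "v \<le> V" using min_var_le[OF a] by (simp add: v_def V)
    have VC: "V \<le> C" using C(4)[OF a, of 2] by (simp add: V_def \<mu>_def)
    have i2: "integrable (int_gaussian a B) (\<lambda>k. (real_of_int k - \<mu>)\<^sup>2)"
      using C(3)[OF a, of \<mu> 2] by simp
    have i1: "integrable (int_gaussian a B) (\<lambda>k. real_of_int k - \<mu>)"
      using C(2)[OF a] by simp
    have e1: "?E (\<lambda>k. real_of_int k - \<mu>) = 0"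
      using C(2)[OF a] by (simp add: \<mu>_def)
    define g where "g k = iexp (\<sigma> * (real_of_int k - \<mu>))" for k
    define y where "y k = 1 + \<i> * complex_of_real (\<sigma> * (real_of_int k - \<mu>))
       - complex_of_real (\<sigma>\<^sup>2 / 2 * (real_of_int k - \<mu>)\<^sup>2)" for k
    have ig: "integrable (int_gaussian a B) g"
      by (rule measure_pmf.integrable_const_bound[where B = 1]) (auto simp: g_def)
    have iy: "integrable (int_gaussian a B) y"
      unfolding y_def using i1 i2 C(2)[OF a]
      by (intro Bochner_Integration.integrable_diff Bochner_Integration.integrable_add
           integrable_mult_right integrable_of_real) auto
    have Ey: "?E y = complex_of_real (1 - \<sigma>\<^sup>2 * V / 2)"
    proof -
      have "?E y = ?E (\<lambda>k. 1) + \<i> * ?E (\<lambda>k. complex_of_real (\<sigma> * (real_of_int k - \<mu>)))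
         - ?E (\<lambda>k. complex_of_real (\<sigma>\<^sup>2 / 2 * (real_of_int k - \<mu>)\<^sup>2))"
        unfolding y_def
        apply (subst Bochner_Integration.integral_diff)
        subgoal using i1 by (intro Bochner_Integration.integrable_add integrable_mult_right integrable_of_real) auto
        subgoal using i2 by (intro integrable_of_real integrable_mult_right) auto
        apply (subst Bochner_Integration.integral_add)
        subgoal by simp
        subgoal using i1 by (intro integrable_mult_right integrable_of_real) auto
        by simp
      also have "\<dots> = 1 + \<i> * complex_of_real (\<sigma> * ?E (\<lambda>k. real_of_int k - \<mu>))
         - complex_of_real (\<sigma>\<^sup>2 / 2 * V)"
        unfolding integral_complex_of_real integral_mult_right_zero V_def by simp
      finally show ?thesis by (simp add: e1)
    qed
    have gy: "norm (g k - y k) \<le> \<bar>\<sigma>\<bar> ^ 3 / 6 * \<bar>real_of_int k - \<mu>\<bar> ^ 3" for k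
    proof -
      have "norm (g k - y k) \<le> \<bar>\<sigma> * (real_of_int k - \<mu>)\<bar> ^ 3 / 6"
        using iexp_approx_quadratic[of "\<sigma> * (real_of_int k - \<mu>)"]
        by (simp only: g_def y_def power_mult_distrib times_divide_eq_left)
      then show ?thesis by (simp add: abs_mult power_mult_distrib)
    qed
    have "norm (?E g - ?E y) = norm (?E (\<lambda>k. g k - y k))"
      using ig iy by simp
    also have "\<dots> \<le> ?E (\<lambda>k. norm (g k - y k))" by (rule integral_norm_bound)
    also have "\<dots> \<le> ?E (\<lambda>k. \<bar>\<sigma>\<bar> ^ 3 / 6 * \<bar>real_of_int k - \<mu>\<bar> ^ 3)"
      using ig iy by (intro integral_mono gy integrable_mult_right C(3)[OF a] integrable_norm) auto
    also have "\<dots> = \<bar>\<sigma>\<bar> ^ 3 / 6 * ?E (\<lambda>k. \<bar>real_of_int k - \<mu>\<bar> ^ 3)" by simp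
    also have "\<dots> \<le> \<bar>\<sigma>\<bar> ^ 3 / 6 * C"
      using C(4)[OF a, of 3] by (intro mult_left_mono) (auto simp: \<mu>_def)
    finally have d: "norm (?E g - ?E y) \<le> \<bar>\<sigma>\<bar> ^ 3 / 6 * C" .
    have "norm (?E g) \<le> norm (?E y) + norm (?E g - ?E y)"
      by (metis add.commute diff_add_cancel norm_triangle_ineq)
    then have Eg: "norm (?E g) \<le> \<bar>1 - \<sigma>\<^sup>2 * V / 2\<bar> + \<bar>\<sigma>\<bar> ^ 3 / 6 * C"
      using d unfolding Ey by (simp only: norm_of_real)
    have Eg1: "norm (?E g) \<le> 1"
    proof -
      have "norm (?E g) \<le> ?E (\<lambda>k. norm (g k))" by (rule integral_norm_bound)
      also have "\<dots> = 1" by (simp add: g_def)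
      finally show ?thesis .
    qed
    have gc: "g k = cis (- \<sigma> * \<mu>) * cis (\<sigma> * real_of_int k)" for k
      unfolding g_def cis_conv_exp exp_add[symmetric] by (simp add: algebra_simps)
    have Egc: "?E g = cis (- \<sigma> * \<mu>) * ?E (\<lambda>k. cis (\<sigma> * real_of_int k))"
      unfolding gc by simp
    have N: "norm (?E (\<lambda>k. cis (\<sigma> * real_of_int k))) = norm (?E g)"
      unfolding Egc by (simp add: norm_mult)
    have s2: "\<sigma>\<^sup>2 = \<bar>\<sigma>\<bar>\<^sup>2" by simp
    have "norm (?E g) \<le> exp (- (v * \<sigma>\<^sup>2 / 2) + C' * \<bar>\<sigma>\<bar> ^ 3)"
    proof (cases "\<sigma>\<^sup>2 * V / 2 \<le> 1")
      case True
      have "norm (?E g) \<le> 1 + (- (\<sigma>\<^sup>2 * V / 2) + \<bar>\<sigma>\<bar> ^ 3 / 6 * C)" using Eg True by simp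
      also have "\<dots> \<le> 1 + (- (v * \<sigma>\<^sup>2 / 2) + C' * \<bar>\<sigma>\<bar> ^ 3)"
      proof -
        have "v * \<sigma>\<^sup>2 \<le> V * \<sigma>\<^sup>2" using vV by (intro mult_right_mono) auto
        moreover have "(C / 6) * \<bar>\<sigma>\<bar> ^ 3 \<le> C' * \<bar>\<sigma>\<bar> ^ 3"
          using C(1) v by (intro mult_right_mono) (auto simp: C'_def)
        ultimately show ?thesis by (simp add: mult.commute)
      qed
      also have "\<dots> \<le> exp (- (v * \<sigma>\<^sup>2 / 2) + C' * \<bar>\<sigma>\<bar> ^ 3)" by (rule exp_ge_add_one_self)
      finally show ?thesis .
    next
      \<comment> \<open>Now \<bar>\<sigma>\<bar> is at least \<open>sqrt (2 / C)\<close>, so by the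
        second summand of \<open>C'\<close> the claimed exponent is nonnegative and the trivial
        bound 1 suffices.\<close>
      case False
      have "2 < \<sigma>\<^sup>2 * V" using False by simp
      also have "\<dots> \<le> \<sigma>\<^sup>2 * C" using VC by (intro mult_left_mono) auto
      finally have "2 / C \<le> \<bar>\<sigma>\<bar>\<^sup>2" using C(1) by (simp add: field_simps)
      then have "sqrt (2 / C) \<le> \<bar>\<sigma>\<bar>" by (intro real_le_lsqrt) auto
      then have "v / (2 * sqrt (2 / C)) * sqrt (2 / C) \<le> C' * \<bar>\<sigma>\<bar>"
        using C(1) v by (intro mult_mono) (auto simp: C'_def)
      then have "v / 2 \<le> C' * \<bar>\<sigma>\<bar>" using C(1) by simp
      then have "v / 2 * \<bar>\<sigma>\<bar>\<^sup>2 \<le> C' * \<bar>\<sigma>\<bar> * \<bar>\<sigma>\<bar>\<^sup>2" by (intro mult_right_mono) auto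
      then have "0 \<le> - (v * \<sigma>\<^sup>2 / 2) + C' * \<bar>\<sigma>\<bar> ^ 3"
        by (simp add: power3_eq_cube power2_eq_square mult.assoc)
      then have "1 \<le> exp (- (v * \<sigma>\<^sup>2 / 2) + C' * \<bar>\<sigma>\<bar> ^ 3)" by simp
      then show ?thesis using Eg1 by linarith
    qed
    then show "norm (?E (\<lambda>k. cis (\<sigma> * real_of_int k))) \<le> exp (- (min_var B * \<sigma>\<^sup>2 / 2) + C' * \<bar>\<sigma>\<bar> ^ 3)"
      by (simp add: N v_def)
  qed
qed

text \<open>An integer shift of the centre multiplies the twisted sum by a unit complex number, and
  reflection reverses the twist. Subtracting the nearest integer thus brings every centre into the
  range over which \<open>min_var\<close> is taken.\<close>

lemma gaussian_theta_twist_le: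
  assumes B: "B > 0"
  obtains C where "C > 0"
    "\<And>a \<sigma>. norm (\<Sum>\<^sub>\<infinity>k::int. exp (- (B / 2 * (real_of_int k - a)\<^sup>2)) *\<^sub>R cis (\<sigma> * real_of_int k))
      \<le> exp (- (min_var B * \<sigma>\<^sup>2 / 2) + C * \<bar>\<sigma>\<bar> ^ 3) * (\<Sum>\<^sub>\<infinity>k::int. exp (- (B / 2 * (real_of_int k - a)\<^sup>2)))"
proof -
  obtain C where C: "C > 0"
    "\<And>a \<sigma>. a \<in> {0..1/2} \<Longrightarrow> norm (measure_pmf.expectation (int_gaussian a B) (\<lambda>k. cis (\<sigma> * real_of_int k)))
      \<le> exp (- (min_var B * \<sigma>\<^sup>2 / 2) + C * \<bar>\<sigma>\<bar> ^ 3)"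
    using int_gaussian_char_le[OF B] by metis
  define T where "T a \<sigma> = (\<Sum>\<^sub>\<infinity>k::int. exp (- (B / 2 * (real_of_int k - a)\<^sup>2)) *\<^sub>R cis (\<sigma> * real_of_int k))" for a \<sigma>
  define Z where "Z a = (\<Sum>\<^sub>\<infinity>k::int. exp (- (B / 2 * (real_of_int k - a)\<^sup>2)))" for a
  define r where "r \<sigma> = exp (- (min_var B * \<sigma>\<^sup>2 / 2) + C * \<bar>\<sigma>\<bar> ^ 3)" for \<sigma>
  have base: "norm (T a \<sigma>) \<le> r \<sigma> * Z a" if a: "a \<in> {0..1/2}" for a \<sigma>
  proof -
    have Z0: "Z a > 0"
    proof -
      obtain Zl Zu :: real where "Zl > 0"
        "\<And>a. a \<in> {0..1/2} \<Longrightarrow> Zl \<le> (\<Sum>\<^sub>\<infinity>j::int. exp (- (B / 2 * (real_of_int j - a)\<^sup>2)))"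
        using int_gaussian_partition_bounds[OF B] by metis
      then show ?thesis using a unfolding Z_def by force
    qed
    have i: "integrable (int_gaussian a B) (\<lambda>k. cis (\<sigma> * real_of_int k))"
      by (rule measure_pmf.integrable_const_bound[where B = 1]) auto
    have "measure_pmf.expectation (int_gaussian a B) (\<lambda>k. cis (\<sigma> * real_of_int k))
      = (\<Sum>\<^sub>\<infinity>k. pmf (int_gaussian a B) k *\<^sub>R cis (\<sigma> * real_of_int k))"
      by (rule integral_measure_pmf_infsum[OF i])
    also have "\<dots> = (\<Sum>\<^sub>\<infinity>k. (1 / Z a) *\<^sub>R (exp (- (B / 2 * (real_of_int k - a)\<^sup>2)) *\<^sub>R cis (\<sigma> * real_of_int k)))"
      unfolding pmf_int_gaussian[OF B] Z_def by simp
    also have "\<dots> = (1 / Z a) *\<^sub>R T a \<sigma>"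
      unfolding T_def by (rule infsum_scaleR_right)
    finally have "norm ((1 / Z a) *\<^sub>R T a \<sigma>) \<le> r \<sigma>" using C(2)[OF a, of \<sigma>] by (simp add: r_def)
    then show ?thesis using Z0 by (simp add: field_simps)
  qed
  have shift: "norm (T (a + real_of_int j) \<sigma>) = norm (T a \<sigma>)" "Z (a + real_of_int j) = Z a" for a j \<sigma>
  proof -
    have bij: "bij_betw (\<lambda>k. k + j) UNIV (UNIV :: int set)"
      by (rule bij_betwI[where g = "\<lambda>k. k - j"]) auto
    have "T (a + real_of_int j) \<sigma>
      = (\<Sum>\<^sub>\<infinity>k::int. exp (- (B / 2 * (real_of_int (k + j) - (a + real_of_int j))\<^sup>2)) *\<^sub>R cis (\<sigma> * real_of_int (k + j)))"
      unfolding T_def by (rule infsum_reindex_bij_betw[OF bij, symmetric])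
    also have "\<dots> = (\<Sum>\<^sub>\<infinity>k::int. cis (\<sigma> * real_of_int j) * (exp (- (B / 2 * (real_of_int k - a)\<^sup>2)) *\<^sub>R cis (\<sigma> * real_of_int k)))"
      by (simp add: distrib_left cis_mult[symmetric] mult_ac)
    also have "\<dots> = cis (\<sigma> * real_of_int j) * T a \<sigma>"
      unfolding T_def by (rule infsum_cmult_right')
    finally show "norm (T (a + real_of_int j) \<sigma>) = norm (T a \<sigma>)" by (simp add: norm_mult)
    have "Z (a + real_of_int j) = (\<Sum>\<^sub>\<infinity>k::int. exp (- (B / 2 * (real_of_int (k + j) - (a + real_of_int j))\<^sup>2)))"
      unfolding Z_def by (rule infsum_reindex_bij_betw[OF bij, symmetric])
    then show "Z (a + real_of_int j) = Z a" by (simp add: Z_def)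
  qed
  have neg: "T (- a) \<sigma> = T a (- \<sigma>)" "Z (- a) = Z a" for a \<sigma>
  proof -
    have bij: "bij_betw uminus UNIV (UNIV :: int set)"
      by (rule bij_betwI[where g = uminus]) auto
    have sq: "(real_of_int (- k) - (- a))\<^sup>2 = (real_of_int k - a)\<^sup>2" for k
      by (simp add: power2_eq_square algebra_simps)
    have "T (- a) \<sigma>
      = (\<Sum>\<^sub>\<infinity>k::int. exp (- (B / 2 * (real_of_int (- k) - (- a))\<^sup>2)) *\<^sub>R cis (\<sigma> * real_of_int (- k)))"
      unfolding T_def by (rule infsum_reindex_bij_betw[OF bij, symmetric])
    then show "T (- a) \<sigma> = T a (- \<sigma>)" unfolding sq T_def by simp
    have "Z (- a) = (\<Sum>\<^sub>\<infinity>k::int. exp (- (B / 2 * (real_of_int (- k) - (- a))\<^sup>2)))"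
      unfolding Z_def by (rule infsum_reindex_bij_betw[OF bij, symmetric])
    then show "Z (- a) = Z a" unfolding sq Z_def .
  qed
  have gen: "norm (T a \<sigma>) \<le> r \<sigma> * Z a" for a \<sigma>
  proof -
    define b where "b = a - real_of_int (round a)"
    have "norm (T b \<sigma>) \<le> r \<sigma> * Z b"
    proof (cases "b \<ge> 0")
      case True
      then show ?thesis using of_int_round_abs_le[of a] by (intro base) (auto simp: b_def)
    next
      case False
      have "norm (T (- b) (- \<sigma>)) \<le> r (- \<sigma>) * Z (- b)"
        using False of_int_round_abs_le[of a] by (intro base) (auto simp: b_def)
      then show ?thesis by (simp add: neg r_def)
    qed
    then show ?thesis using shift[of b "round a"] by (simp add: b_def)
  qed
  show ?thesis
    using that[OF C(1)] gen unfolding T_def Z_def r_def by blast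
qed

section \<open>Positive definite kernels on the integers\<close>

text \<open>The line is cut into translates of [0, L). The bound \<open>K\<close> on all finite
  partial sums supplies the dominating function for exchanging the integral with the sum over
  translates.\<close>

lemma integral_periodic_fold:
  fixes F :: "real \<Rightarrow> 'b::{banach, second_countable_topology}"
  assumes L: "L > 0" and F: "integrable lborel F"
    and sm: "\<And>x. x \<in> {0..<L} \<Longrightarrow> (\<lambda>m::int. F (x + L * real_of_int m)) summable_on UNIV"
    and bd: "\<And>x M. x \<in> {0..<L} \<Longrightarrow> finite M \<Longrightarrow> norm (\<Sum>m\<in>M. F (x + L * real_of_int m)) \<le> K"
  defines "G \<equiv> \<lambda>x. indicator {0..<L} x *\<^sub>R (\<Sum>\<^sub>\<infinity>m::int. F (x + L * real_of_int m))"
  shows "integrable lborel G" "integral\<^sup>L lborel F = integral\<^sup>L lborel G"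
proof -
  have Fm [measurable]: "F \<in> borel_measurable borel" using F by auto
  define I where "I N = {- int N..<int N}" for N
  define S where "S N x = indicator {- L * real N..<L * real N} x *\<^sub>R F x" for N x
  define T where "T N x = indicator {0..<L} x *\<^sub>R (\<Sum>m\<in>I N. F (x + L * real_of_int m))" for N x
  have SI: "integrable lborel (S N)" for N
    unfolding S_def by (intro integrable_mult_indicator F) auto
  \<comment> \<open>Every point lies in exactly one translate, the one with index
    \<open>floor (x / L)\<close>.\<close>
  have ind: "indicator {- L * real N..<L * real N} x = (\<Sum>m\<in>I N. indicator {0..<L} (x - L * real_of_int m) :: real)" for N x
  proof -
    define f where "f = floor (x / L)"
    have fm: "x - L * real_of_int m \<in> {0..<L} \<longleftrightarrow> m = f" for m
    proof -
      have "x - L * real_of_int m \<in> {0..<L} \<longleftrightarrow> real_of_int m \<le> x / L \<and> x / L < real_of_int m + 1"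
        using L by (auto simp: field_simps)
      also have "\<dots> \<longleftrightarrow> m = f" unfolding f_def by (metis floor_eq_iff)
      finally show ?thesis .
    qed
    have fI: "x \<in> {- L * real N..<L * real N} \<longleftrightarrow> f \<in> I N"
    proof -
      have "x \<in> {- L * real N..<L * real N} \<longleftrightarrow> real_of_int (- int N) \<le> x / L \<and> x / L < real_of_int (int N)"
        using L by (auto simp: field_simps)
      also have "\<dots> \<longleftrightarrow> f \<in> I N" unfolding f_def I_def by (simp add: le_floor_iff floor_less_iff)
      finally show ?thesis .
    qed
    have "(\<Sum>m\<in>I N. indicator {0..<L} (x - L * real_of_int m) :: real) = (\<Sum>m\<in>I N. if m = f then 1 else 0)"
      using fm by (intro sum.cong refl) (simp add: indicator_def)
    also have "\<dots> = (if f \<in> I N then 1 else 0)" by (simp add: I_def)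
    finally show ?thesis using fI by (simp add: indicator_def)
  qed
  have shift: "integrable lborel (\<lambda>x. indicator {0..<L} (x - L * real_of_int m) *\<^sub>R F x)"
    "integrable lborel (\<lambda>x. indicator {0..<L} x *\<^sub>R F (x + L * real_of_int m))"
    "(\<integral>x. indicator {0..<L} (x - L * real_of_int m) *\<^sub>R F x \<partial>lborel)
      = (\<integral>x. indicator {0..<L} x *\<^sub>R F (x + L * real_of_int m) \<partial>lborel)" for m
  proof -
    have e: "indicator {0..<L} (x - L * real_of_int m) = (indicator ({L * real_of_int m..<L * real_of_int m + L}) x :: real)" for x
      by (auto simp: indicator_def)
    show i: "integrable lborel (\<lambda>x. indicator {0..<L} (x - L * real_of_int m) *\<^sub>R F x)"
      unfolding e by (intro integrable_mult_indicator F) auto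
    show "integrable lborel (\<lambda>x. indicator {0..<L} x *\<^sub>R F (x + L * real_of_int m))"
      using lborel_integrable_real_affine[OF i, of 1 "L * real_of_int m"] by (simp add: add.commute)
    show "(\<integral>x. indicator {0..<L} (x - L * real_of_int m) *\<^sub>R F x \<partial>lborel)
      = (\<integral>x. indicator {0..<L} x *\<^sub>R F (x + L * real_of_int m) \<partial>lborel)"
      by (subst lborel_integral_real_affine[where c = 1 and t = "L * real_of_int m"]) (simp_all add: add.commute)
  qed
  have ST: "integral\<^sup>L lborel (S N) = integral\<^sup>L lborel (T N)" for N
  proof -
    have "integral\<^sup>L lborel (S N) = (\<integral>x. (\<Sum>m\<in>I N. indicator {0..<L} (x - L * real_of_int m) *\<^sub>R F x) \<partial>lborel)"
      unfolding S_def ind scaleR_left.sum ..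
    also have "\<dots> = (\<Sum>m\<in>I N. \<integral>x. indicator {0..<L} x *\<^sub>R F (x + L * real_of_int m) \<partial>lborel)"
      by (subst Bochner_Integration.integral_sum) (simp_all add: shift)
    also have "\<dots> = (\<integral>x. (\<Sum>m\<in>I N. indicator {0..<L} x *\<^sub>R F (x + L * real_of_int m)) \<partial>lborel)"
      by (subst Bochner_Integration.integral_sum) (simp_all add: shift)
    also have "\<dots> = integral\<^sup>L lborel (T N)"
      unfolding T_def scaleR_right.sum ..
    finally show ?thesis .
  qed
  have Slim: "(\<lambda>N. S N x) \<longlonglongrightarrow> F x" for x
  proof (rule tendsto_eventually)
    obtain n :: nat where n: "\<bar>x\<bar> < real n * L" using reals_Archimedean3[OF L] by blast
    have "S N x = F x" if "N \<ge> n" for N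
    proof -
      have "real n * L \<le> real N * L" using that L by simp
      then have "x \<in> {- L * real N..<L * real N}" using n by (auto simp: mult.commute)
      then show ?thesis by (simp add: S_def)
    qed
    then show "\<forall>\<^sub>F N in sequentially. S N x = F x" by (auto simp: eventually_sequentially)
  qed
  have Slim2: "(\<lambda>N. integral\<^sup>L lborel (S N)) \<longlonglongrightarrow> integral\<^sup>L lborel F"
  proof (rule integral_dominated_convergence[where w = "\<lambda>x. norm (F x)"])
    show "AE x in lborel. norm (S N x) \<le> norm (F x)" for N by (auto simp: S_def indicator_def)
  qed (use F SI Slim in auto)
  \<comment> \<open>\<open>infsum\<close> is a limit along all finite sets; the windows
    \<open>I N\<close> eventually contain each of them, so the limit may be taken along
    \<open>N\<close>.\<close>
  have If: "filterlim I (finite_subsets_at_top UNIV) sequentially"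
  proof (rule filterlim_finite_subsets_at_top[THEN iffD2], safe)
    fix X :: "int set" assume "finite X"
    then obtain n where n: "\<And>m. m \<in> X \<Longrightarrow> \<bar>m\<bar> < int n"
    proof -
      assume *: "\<And>n. (\<And>m. m \<in> X \<Longrightarrow> \<bar>m\<bar> < int n) \<Longrightarrow> thesis"
      have "\<bar>m\<bar> \<le> Max (insert 0 (abs ` X))" if "m \<in> X" for m
        using \<open>finite X\<close> that by (intro Max_ge) auto
      then show thesis
        by (intro *[of "nat (Max (insert 0 (abs ` X)) + 1)"]) (smt (verit) int_nat_eq zero_less_nat_eq)
    qed
    show "\<forall>\<^sub>F N in sequentially. finite (I N) \<and> X \<subseteq> I N \<and> I N \<subseteq> UNIV"
      using eventually_ge_at_top[of n]
    proof eventually_elim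
      case (elim N)
      then show ?case using n unfolding I_def by (auto simp: abs_less_iff) (smt (verit) n of_nat_le_iff)+
    qed
  qed
  have Tlim: "(\<lambda>N. T N x) \<longlonglongrightarrow> G x" for x
  proof (cases "x \<in> {0..<L}")
    case True
    have "((\<lambda>X. \<Sum>m\<in>X. F (x + L * real_of_int m)) \<longlongrightarrow> (\<Sum>\<^sub>\<infinity>m::int. F (x + L * real_of_int m))) (finite_subsets_at_top UNIV)"
      using has_sum_infsum[OF sm[OF True]] by (simp add: has_sum_def)
    from filterlim_compose[OF this If] show ?thesis using True by (simp add: T_def G_def)
  next
    case False
    then show ?thesis by (simp add: T_def G_def)
  qed
  have Tm: "T N \<in> borel_measurable lborel" for N
    unfolding T_def by measurable
  have Gm: "G \<in> borel_measurable lborel"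
    by (rule borel_measurable_LIMSEQ_metric[OF Tm Tlim])
  have w: "integrable lborel (\<lambda>x. indicator {0..<L} x * K)"
    using L by (intro integrable_mult_left) (simp add: integrable_indicator_iff)
  have dom: "AE x in lborel. norm (T N x) \<le> indicator {0..<L} x * K" for N
  proof (rule AE_I2)
    fix x
    show "norm (T N x) \<le> indicator {0..<L} x * K"
      using bd[of x "I N"] by (cases "x \<in> {0..<L}") (auto simp: T_def I_def)
  qed
  show "integrable lborel G"
    by (rule integrable_dominated_convergence[OF Gm Tm w AE_I2[OF Tlim] dom])
  have "(\<lambda>N. integral\<^sup>L lborel (T N)) \<longlonglongrightarrow> integral\<^sup>L lborel G"
    by (rule integral_dominated_convergence[OF Gm Tm w AE_I2[OF Tlim] dom])
  then show "integral\<^sup>L lborel F = integral\<^sup>L lborel G"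
    using Slim2 unfolding ST by (rule LIMSEQ_unique[rotated])
qed

text \<open>A comparison on each residue class modulo \<open>L\<close> integrates to a comparison of
  the full integrals. This plays the role of conditioning on the value modulo the period.\<close>

lemma integral_periodic_mult_le:
  fixes F :: "real \<Rightarrow> complex" and H :: "real \<Rightarrow> real"
  assumes L: "L > 0" and F: "integrable lborel F" and H: "integrable lborel H"
    and sF: "\<And>x. x \<in> {0..<L} \<Longrightarrow> (\<lambda>m::int. F (x + L * real_of_int m)) summable_on UNIV"
    and bF: "\<And>x M. x \<in> {0..<L} \<Longrightarrow> finite M \<Longrightarrow> norm (\<Sum>m\<in>M. F (x + L * real_of_int m)) \<le> K"
    and sH: "\<And>x. x \<in> {0..<L} \<Longrightarrow> (\<lambda>m::int. H (x + L * real_of_int m)) summable_on UNIV"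
    and bH: "\<And>x M. x \<in> {0..<L} \<Longrightarrow> finite M \<Longrightarrow> norm (\<Sum>m\<in>M. H (x + L * real_of_int m)) \<le> K"
    and le: "\<And>x. x \<in> {0..<L} \<Longrightarrow> norm (\<Sum>\<^sub>\<infinity>m::int. F (x + L * real_of_int m))
      \<le> r * (\<Sum>\<^sub>\<infinity>m::int. H (x + L * real_of_int m))"
  shows "norm (integral\<^sup>L lborel F) \<le> r * integral\<^sup>L lborel H"
proof -
  have f: "integrable lborel (\<lambda>x. indicator {0..<L} x *\<^sub>R (\<Sum>\<^sub>\<infinity>m::int. F (x + L * real_of_int m)))"
    "integral\<^sup>L lborel F = (\<integral>x. indicator {0..<L} x *\<^sub>R (\<Sum>\<^sub>\<infinity>m::int. F (x + L * real_of_int m)) \<partial>lborel)"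
    using integral_periodic_fold[OF L F sF bF] by blast+
  have h: "integrable lborel (\<lambda>x. indicator {0..<L} x *\<^sub>R (\<Sum>\<^sub>\<infinity>m::int. H (x + L * real_of_int m)))"
    "integral\<^sup>L lborel H = (\<integral>x. indicator {0..<L} x *\<^sub>R (\<Sum>\<^sub>\<infinity>m::int. H (x + L * real_of_int m)) \<partial>lborel)"
    using integral_periodic_fold[OF L H sH bH] by blast+
  have "norm (integral\<^sup>L lborel F)
    \<le> (\<integral>x. norm (indicator {0..<L} x *\<^sub>R (\<Sum>\<^sub>\<infinity>m::int. F (x + L * real_of_int m))) \<partial>lborel)"
    unfolding f(2) by (rule integral_norm_bound)
  also have "\<dots> \<le> (\<integral>x. r * (indicator {0..<L} x *\<^sub>R (\<Sum>\<^sub>\<infinity>m::int. H (x + L * real_of_int m))) \<partial>lborel)"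
  proof (rule integral_mono)
    show "integrable lborel (\<lambda>x. norm (indicator {0..<L} x *\<^sub>R (\<Sum>\<^sub>\<infinity>m::int. F (x + L * real_of_int m))))"
      by (rule integrable_norm[OF f(1)])
    show "integrable lborel (\<lambda>x. r * (indicator {0..<L} x *\<^sub>R (\<Sum>\<^sub>\<infinity>m::int. H (x + L * real_of_int m))))"
      by (rule integrable_mult_right[OF h(1)])
    show "norm (indicator {0..<L} x *\<^sub>R (\<Sum>\<^sub>\<infinity>m::int. F (x + L * real_of_int m)))
      \<le> r * (indicator {0..<L} x *\<^sub>R (\<Sum>\<^sub>\<infinity>m::int. H (x + L * real_of_int m)))" for x
      using le[of x] by (cases "x \<in> {0..<L}") auto
  qed
  also have "\<dots> = r * integral\<^sup>L lborel H"
    unfolding h(2) by simp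
  finally show ?thesis .
qed


text \<open>Up to the cubic correction this is
  \<open>exp (- error_M \<beta> * s\<^sup>2 / (2 * \<beta>))\<close>, the Gaussian edge weight at
  \<open>s\<close> to the power \<open>error_M \<beta>\<close>. The twist of the integer part is
  \<open>2 * pi * s\<close>, because a period of the frequency changes the phase by that
  amount.\<close>

definition theta_rate :: "real \<Rightarrow> real \<Rightarrow> real \<Rightarrow> real" where
  "theta_rate \<beta> C s = exp (- (min_var ((2 * pi)\<^sup>2 * \<beta>) * (2 * pi * s)\<^sup>2 / 2) + C * \<bar>2 * pi * s\<bar> ^ 3)"

section \<open>Gaussian edge weights as Fourier transforms\<close>

lemma gaussian_cis_transform:
  assumes b: "\<beta> > 0"
  shows "complex_of_real (exp (- (y\<^sup>2 / (2 * \<beta>)))) = (\<integral>x. std_normal_density x *\<^sub>R cis (x * y / sqrt \<beta>) \<partial>lborel)"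
proof -
  have "char std_normal_distribution (y / sqrt \<beta>) = complex_of_real (exp (- (y\<^sup>2 / (2 * \<beta>))))"
    unfolding char_std_normal_distribution using b by (simp add: power_divide)
  moreover have "char std_normal_distribution (y / sqrt \<beta>)
      = (\<integral>x. std_normal_density x *\<^sub>R iexp (y / sqrt \<beta> * x) \<partial>lborel)"
    unfolding char_def by (subst integral_density) auto
  moreover have "iexp (y / sqrt \<beta> * x) = cis (x * y / sqrt \<beta>)" for x
    by (simp add: cis_conv_exp mult_ac)
  ultimately show ?thesis by simp
qed

lemma integrable_std_normal_mult:
  fixes f :: "real \<Rightarrow> 'b::{banach, second_countable_topology}"
  assumes [measurable]: "f \<in> borel_measurable borel" and bd: "\<And>x. norm (f x) \<le> K"
  shows "integrable lborel (\<lambda>x. std_normal_density x *\<^sub>R f x)"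
proof (rule Bochner_Integration.integrable_bound)
  show "integrable lborel (\<lambda>x. std_normal_density x * K)"
    by (intro integrable_mult_left integrable_normal_density) auto
  show "AE x in lborel. norm (std_normal_density x *\<^sub>R f x) \<le> norm (std_normal_density x * K)"
  proof (rule AE_I2)
    fix x
    have "norm (std_normal_density x *\<^sub>R f x) = std_normal_density x * norm (f x)" by simp
    also have "\<dots> \<le> std_normal_density x * K" by (intro mult_left_mono bd) auto
    also have "\<dots> \<le> norm (std_normal_density x * K)" by simp
    finally show "norm (std_normal_density x *\<^sub>R f x) \<le> norm (std_normal_density x * K)" .
  qed
qed simp

text \<open>On a residue class modulo \<open>2 * pi * sqrt \<beta>\<close> the functions
  \<open>Q\<close> and \<open>q\<close> are constant and the normal density is a multiple of an
  integer Gaussian weight, so only the phase is left to average. The majorant \<open>q\<close> is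
  kept separate from \<open>norm (Q x)\<close> so that the bound can be iterated over edges.\<close>

lemma gaussian_twist_periodic_le:
  assumes b: "\<beta> > 0"
  obtains C where "C > 0"
    "\<And>Q q s Kq. (\<And>x. norm (Q x) \<le> q x) \<Longrightarrow> (\<And>x::real. q x \<le> Kq) \<Longrightarrow>
      Q \<in> borel_measurable borel \<Longrightarrow> q \<in> borel_measurable borel \<Longrightarrow>
      (\<And>x m::int. Q (x + 2 * pi * sqrt \<beta> * real_of_int m) = Q x) \<Longrightarrow>
      (\<And>x m::int. q (x + 2 * pi * sqrt \<beta> * real_of_int m) = q x) \<Longrightarrow>
      norm (\<integral>x. std_normal_density x *\<^sub>R (cis (- (x * s / sqrt \<beta>)) * Q x) \<partial>lborel)
        \<le> theta_rate \<beta> C s * (\<integral>x. std_normal_density x * q x \<partial>lborel)"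
proof -
  define B where "B = (2 * pi)\<^sup>2 * \<beta>"
  define L where "L = 2 * pi * sqrt \<beta>"
  have B: "B > 0" and L: "L > 0" using b by (auto simp: B_def L_def)
  have L2: "L\<^sup>2 = B" using b by (simp add: L_def B_def power_mult_distrib)
  have Ls: "L / sqrt \<beta> = 2 * pi" using b by (simp add: L_def)
  obtain C where C: "C > 0"
    "\<And>a \<sigma>. norm (\<Sum>\<^sub>\<infinity>k::int. exp (- (B / 2 * (real_of_int k - a)\<^sup>2)) *\<^sub>R cis (\<sigma> * real_of_int k))
      \<le> exp (- (min_var B * \<sigma>\<^sup>2 / 2) + C * \<bar>\<sigma>\<bar> ^ 3) * (\<Sum>\<^sub>\<infinity>k::int. exp (- (B / 2 * (real_of_int k - a)\<^sup>2)))"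
    using gaussian_theta_twist_le[OF B] by blast
  show ?thesis
  proof (rule that[OF C(1)])
    fix Q :: "real \<Rightarrow> complex" and q :: "real \<Rightarrow> real" and s Kq :: real
    assume Qq: "\<And>x. norm (Q x) \<le> q x" and qK: "\<And>x. q x \<le> Kq"
      and [measurable]: "Q \<in> borel_measurable borel" "q \<in> borel_measurable borel"
      and Qper: "\<And>x m::int. Q (x + 2 * pi * sqrt \<beta> * real_of_int m) = Q x"
      and qper: "\<And>x m::int. q (x + 2 * pi * sqrt \<beta> * real_of_int m) = q x"
    have q0: "q x \<ge> 0" for x using Qq[of x] norm_ge_zero order_trans by blast
    have QK: "norm (Q x) \<le> Kq" for x using Qq qK order_trans by blast
    have Kq0: "Kq \<ge> 0" using q0[of 0] qK[of 0] by linarith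
    define c0 where "c0 = 1 / sqrt (2 * pi)"
    have c0: "c0 > 0" by (simp add: c0_def)
    define w where "w a k = exp (- (B / 2 * (real_of_int k - a)\<^sup>2))" for a k
    have w0: "w a k > 0" for a k by (simp add: w_def)
    have wsm: "(\<lambda>k. w a k) summable_on UNIV" for a
      unfolding w_def by (rule summable_int_gaussian[OF B])
    \<comment> \<open>Reading \<open>x + L * m\<close> as \<open>L * (m - a)\<close> with
      \<open>a = - x / L\<close>; the parameter
      \<open>L\<^sup>2 = (2 * pi)\<^sup>2 * \<beta>\<close> is the one occurring in
      \<open>error_M\<close>.\<close>
    have dens: "std_normal_density (x + L * real_of_int m) = c0 * w (- x / L) m" for x m
    proof -
      have "x + L * real_of_int m = L * (real_of_int m - (- x / L))"
        using L by (simp add: field_simps)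
      then have "(x + L * real_of_int m)\<^sup>2 = L\<^sup>2 * (real_of_int m - (- x / L))\<^sup>2"
        by (simp only: power_mult_distrib)
      then show ?thesis by (simp add: std_normal_density_def c0_def w_def L2)
    qed
    define F where "F x = std_normal_density x *\<^sub>R (cis (- (x * s / sqrt \<beta>)) * Q x)" for x
    define H where "H x = std_normal_density x * q x" for x
    define \<sigma> where "\<sigma> = - (2 * pi * s)"
    have Fm: "F (x + L * real_of_int m)
        = (c0 * cis (- (x * s / sqrt \<beta>)) * Q x) * (w (- x / L) m *\<^sub>R cis (\<sigma> * real_of_int m))" for x m
    proof -
      have "- ((x + L * real_of_int m) * s / sqrt \<beta>) = - (x * s / sqrt \<beta>) + \<sigma> * real_of_int m"
        using Ls by (simp add: \<sigma>_def add_divide_distrib distrib_right) (metis mult.commute times_divide_eq_right mult.assoc)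
      then have "cis (- ((x + L * real_of_int m) * s / sqrt \<beta>)) = cis (- (x * s / sqrt \<beta>)) * cis (\<sigma> * real_of_int m)"
        by (simp add: cis_mult)
      then show ?thesis using Qper[of x m] unfolding F_def dens by (simp add: L_def scaleR_conv_of_real)
    qed
    have Hm: "H (x + L * real_of_int m) = (c0 * q x) * w (- x / L) m" for x m
      using qper[of x m] unfolding H_def dens by (simp add: L_def)
    define S where "S = (\<Sum>\<^sub>\<infinity>k::int. exp B * exp (- (B / 2) * \<bar>real_of_int k\<bar>))"
    have sS: "(\<lambda>k::int. exp B * exp (- (B / 2) * \<bar>real_of_int k\<bar>)) summable_on UNIV"
      using B by (intro summable_on_cmult_right summable_on_exp_abs_int) auto
    have wS: "(\<Sum>m\<in>M. w (- x / L) m) \<le> S" if x: "x \<in> {0..<L}" and M: "finite M" for x M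
    proof -
      have "(\<Sum>m\<in>M. w (- x / L) m) \<le> (\<Sum>m\<in>M. exp B * exp (- (B / 2) * \<bar>real_of_int m\<bar>))"
        unfolding w_def using x L by (intro sum_mono int_gaussian_weight_le B) (auto simp: field_simps)
      also have "\<dots> \<le> S"
        unfolding S_def by (rule finite_sum_le_infsum[OF sS M]) auto
      finally show ?thesis .
    qed
    have ws: "(\<lambda>m. w a m *\<^sub>R cis (\<sigma> * real_of_int m)) summable_on UNIV" for a
      by (rule abs_summable_summable) (use wsm[of a] w0[of a] in \<open>simp add: abs_of_pos\<close>)
    show "norm (\<integral>x. std_normal_density x *\<^sub>R (cis (- (x * s / sqrt \<beta>)) * Q x) \<partial>lborel)
        \<le> theta_rate \<beta> C s * (\<integral>x. std_normal_density x * q x \<partial>lborel)"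
      unfolding F_def[symmetric] H_def[symmetric]
    proof (rule integral_periodic_mult_le[OF L, where K = "c0 * Kq * S"])
      show "integrable lborel F" unfolding F_def
        by (rule integrable_std_normal_mult[where K = Kq]) (auto simp: norm_mult QK cis_conv_exp)
      show "integrable lborel H" unfolding H_def
        using integrable_std_normal_mult[of q Kq] q0 qK by auto
      fix x assume x: "x \<in> {0..<L}"
      show "(\<lambda>m. F (x + L * real_of_int m)) summable_on UNIV"
        unfolding Fm by (intro summable_on_cmult_right ws)
      show "(\<lambda>m. H (x + L * real_of_int m)) summable_on UNIV"
        unfolding Hm by (intro summable_on_cmult_right wsm)
      have bd: "c0 * q x * (\<Sum>m\<in>M. w (- x / L) m) \<le> c0 * Kq * S" if "finite M" for M
        using wS[OF x that] c0 Kq0 qK q0 by (intro mult_mono sum_nonneg) (auto intro: less_imp_le[OF w0])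
      show "norm (\<Sum>m\<in>M. H (x + L * real_of_int m)) \<le> c0 * Kq * S" if "finite M" for M
      proof -
        have "norm (\<Sum>m\<in>M. H (x + L * real_of_int m)) = c0 * q x * (\<Sum>m\<in>M. w (- x / L) m)"
          unfolding Hm sum_distrib_left[symmetric] using c0 q0[of x] sum_nonneg[of M "w (- x / L)"] w0
          by (simp add: abs_mult less_imp_le)
        then show ?thesis using bd[OF that] by simp
      qed
      show "norm (\<Sum>m\<in>M. F (x + L * real_of_int m)) \<le> c0 * Kq * S" if "finite M" for M
      proof -
        have "norm (\<Sum>m\<in>M. F (x + L * real_of_int m)) \<le> (\<Sum>m\<in>M. norm (F (x + L * real_of_int m)))"
          by (rule norm_sum)
        also have "\<dots> \<le> (\<Sum>m\<in>M. c0 * q x * w (- x / L) m)"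
        proof (rule sum_mono)
          fix m
          have "norm (F (x + L * real_of_int m)) = c0 * norm (Q x) * w (- x / L) m"
            unfolding Fm using c0 less_imp_le[OF w0] by (simp add: norm_mult)
          also have "\<dots> \<le> c0 * q x * w (- x / L) m"
            using c0 Qq[of x] less_imp_le[OF w0] by (intro mult_right_mono mult_left_mono) auto
          finally show "norm (F (x + L * real_of_int m)) \<le> c0 * q x * w (- x / L) m" .
        qed
        finally show ?thesis using bd[OF that] by (simp add: sum_distrib_left)
      qed
      have "norm (\<Sum>\<^sub>\<infinity>m. F (x + L * real_of_int m))
        = c0 * norm (Q x) * norm (\<Sum>\<^sub>\<infinity>m. w (- x / L) m *\<^sub>R cis (\<sigma> * real_of_int m))"
        unfolding Fm infsum_cmult_right' using c0 by (simp add: norm_mult)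
      also have "\<dots> \<le> c0 * q x * (theta_rate \<beta> C s * (\<Sum>\<^sub>\<infinity>m. w (- x / L) m))"
      proof -
        have "norm (\<Sum>\<^sub>\<infinity>m. w (- x / L) m *\<^sub>R cis (\<sigma> * real_of_int m))
            \<le> theta_rate \<beta> C s * (\<Sum>\<^sub>\<infinity>m. w (- x / L) m)"
          using C(2)[of "- x / L" \<sigma>] unfolding w_def theta_rate_def B_def[symmetric] \<sigma>_def by simp
        then show ?thesis using c0 Qq[of x] q0[of x] by (intro mult_mono) auto
      qed
      also have "\<dots> = theta_rate \<beta> C s * (\<Sum>\<^sub>\<infinity>m. H (x + L * real_of_int m))"
        unfolding Hm infsum_cmult_right' by simp
      finally show "norm (\<Sum>\<^sub>\<infinity>m. F (x + L * real_of_int m)) \<le> theta_rate \<beta> C s * (\<Sum>\<^sub>\<infinity>m. H (x + L * real_of_int m))" .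
    qed
  qed
qed

lemma hermitian_form_product:
  fixes A :: "'c \<Rightarrow> 'c \<Rightarrow> complex"
  shows "(\<Sum>i\<in>J. \<Sum>j\<in>J. (z i * \<zeta> i) * cnj (z j * \<zeta> j) * A i j)
    = (\<Sum>i\<in>J. \<Sum>j\<in>J. z i * cnj (z j) * A i j * (\<zeta> i * cnj (\<zeta> j)))"
  by (intro sum.cong refl) (simp add: mult_ac)

text \<open>Bochner's theorem for one edge factor: the phases of its Fourier transform are absorbed
  into z, and what remains is a periodic function of the frequency.\<close>

lemma gaussian_kernel_step:
  fixes d :: "'c \<Rightarrow> int" and A P :: "'c \<Rightarrow> 'c \<Rightarrow> complex"
  assumes b: "\<beta> > 0" and J: "finite J"
    and C: "\<And>Q q s Kq. (\<And>x. norm (Q x) \<le> q x) \<Longrightarrow> (\<And>x::real. q x \<le> Kq) \<Longrightarrow>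
      Q \<in> borel_measurable borel \<Longrightarrow> q \<in> borel_measurable borel \<Longrightarrow>
      (\<And>x m::int. Q (x + 2 * pi * sqrt \<beta> * real_of_int m) = Q x) \<Longrightarrow>
      (\<And>x m::int. q (x + 2 * pi * sqrt \<beta> * real_of_int m) = q x) \<Longrightarrow>
      norm (\<integral>x. std_normal_density x *\<^sub>R (cis (- (x * s / sqrt \<beta>)) * Q x) \<partial>lborel)
        \<le> theta_rate \<beta> C s * (\<integral>x. std_normal_density x * q x \<partial>lborel)"
    and dom: "\<And>z. norm (\<Sum>i\<in>J. \<Sum>j\<in>J. z i * cnj (z j) * A i j)
      \<le> r * Re (\<Sum>i\<in>J. \<Sum>j\<in>J. z i * cnj (z j) * P i j)"
  shows "norm (\<Sum>i\<in>J. \<Sum>j\<in>J. z i * cnj (z j)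
        * (A i j * complex_of_real (exp (- ((real_of_int (d i - d j) - s)\<^sup>2 / (2 * \<beta>))))))
      \<le> (theta_rate \<beta> C s * r) * Re (\<Sum>i\<in>J. \<Sum>j\<in>J. z i * cnj (z j)
        * (P i j * complex_of_real (exp (- ((real_of_int (d i - d j))\<^sup>2 / (2 * \<beta>))))))"
proof -
  define e where "e x i = cis (x * real_of_int (d i) / sqrt \<beta>)" for x i
  define Q where "Q x = (\<Sum>i\<in>J. \<Sum>j\<in>J. (z i * e x i) * cnj (z j * e x j) * A i j)" for x
  define R where "R x = (\<Sum>i\<in>J. \<Sum>j\<in>J. (z i * e x i) * cnj (z j * e x j) * P i j)" for x
  have em [measurable]: "(\<lambda>x. e x i) \<in> borel_measurable borel" for i
    unfolding e_def cis_conv_exp by measurable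
  have cm [measurable]: "(\<lambda>x. cnj (e x i)) \<in> borel_measurable borel" for i
    unfolding e_def using b by (intro borel_measurable_continuous_onI continuous_intros) auto
  have ee: "e x i * cnj (e x j) = cis (x * real_of_int (d i - d j) / sqrt \<beta>)" for x i j
    by (simp add: e_def cis_cnj cis_mult diff_divide_distrib right_diff_distrib)
  \<comment> \<open>Integrality of the gradients enters here: \<open>m * d i\<close> is an
    integer.\<close>
  have eper: "e (x + 2 * pi * sqrt \<beta> * real_of_int m) i = e x i" for x m i
  proof -
    have "(x + 2 * pi * sqrt \<beta> * real_of_int m) * real_of_int (d i) / sqrt \<beta>
        = x * real_of_int (d i) / sqrt \<beta> + 2 * pi * real_of_int (m * d i)"
      using b by (simp add: field_simps)
    moreover have "cis (2 * pi * real_of_int (m * d i)) = 1" by (rule cis_multiple_2pi) auto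
    ultimately show ?thesis unfolding e_def by (simp add: cis_mult[symmetric])
  qed
  \<comment> \<open>Integrating over the frequency turns the phases back into a Gaussian factor
    shifted by \<open>t\<close>. This is used with \<open>t = s\<close> for \<open>A\<close> and
    with \<open>t = 0\<close> for \<open>P\<close>.\<close>
  have wave: "(\<integral>x. std_normal_density x *\<^sub>R (cis (- (x * t / sqrt \<beta>)) *
        (\<Sum>i\<in>J. \<Sum>j\<in>J. (z i * e x i) * cnj (z j * e x j) * M i j)) \<partial>lborel)
     = (\<Sum>i\<in>J. \<Sum>j\<in>J. z i * cnj (z j)
        * (M i j * complex_of_real (exp (- ((real_of_int (d i - d j) - t)\<^sup>2 / (2 * \<beta>))))))" for M t
  proof -
    have i: "integrable lborel (\<lambda>x. std_normal_density x *\<^sub>R cis (x * y / sqrt \<beta>))" for y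
      by (rule integrable_std_normal_mult[where K = 1]) (auto simp: cis_conv_exp)
    have "std_normal_density x *\<^sub>R (cis (- (x * t / sqrt \<beta>)) *
        (\<Sum>i\<in>J. \<Sum>j\<in>J. (z i * e x i) * cnj (z j * e x j) * M i j))
      = (\<Sum>i\<in>J. \<Sum>j\<in>J. (z i * cnj (z j) * M i j) *
          (std_normal_density x *\<^sub>R cis (x * (real_of_int (d i - d j) - t) / sqrt \<beta>)))" for x
    proof -
      have "cis (- (x * t / sqrt \<beta>)) * (e x i * cnj (e x j)) = cis (x * (real_of_int (d i - d j) - t) / sqrt \<beta>)" for i j
        unfolding ee cis_mult by (simp add: diff_divide_distrib right_diff_distrib)
      then show ?thesis
        unfolding hermitian_form_product sum_distrib_left scaleR_sum_right
        by (intro sum.cong refl) (simp add: mult_ac scaleR_conv_of_real)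
    qed
    then have "(\<integral>x. std_normal_density x *\<^sub>R (cis (- (x * t / sqrt \<beta>)) *
        (\<Sum>i\<in>J. \<Sum>j\<in>J. (z i * e x i) * cnj (z j * e x j) * M i j)) \<partial>lborel)
      = (\<integral>x. (\<Sum>i\<in>J. \<Sum>j\<in>J. (z i * cnj (z j) * M i j) *
          (std_normal_density x *\<^sub>R cis (x * (real_of_int (d i - d j) - t) / sqrt \<beta>))) \<partial>lborel)"
      by (simp only:)
    also have "\<dots> = (\<Sum>i\<in>J. \<integral>x. (\<Sum>j\<in>J. (z i * cnj (z j) * M i j) *
          (std_normal_density x *\<^sub>R cis (x * (real_of_int (d i - d j) - t) / sqrt \<beta>))) \<partial>lborel)"
      by (rule Bochner_Integration.integral_sum) (intro Bochner_Integration.integrable_sum integrable_mult_right i)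
    also have "\<dots> = (\<Sum>i\<in>J. \<Sum>j\<in>J. \<integral>x. (z i * cnj (z j) * M i j) *
          (std_normal_density x *\<^sub>R cis (x * (real_of_int (d i - d j) - t) / sqrt \<beta>)) \<partial>lborel)"
      by (intro sum.cong refl Bochner_Integration.integral_sum integrable_mult_right i)
    also have "\<dots> = (\<Sum>i\<in>J. \<Sum>j\<in>J. (z i * cnj (z j) * M i j) *
         complex_of_real (exp (- ((real_of_int (d i - d j) - t)\<^sup>2 / (2 * \<beta>)))))"
      unfolding integral_mult_right_zero gaussian_cis_transform[OF b] ..
    finally show ?thesis by (simp only: mult.assoc)
  qed
  \<comment> \<open>\<open>dom\<close> is assumed for all coefficients so that it applies at every
    frequency, where the coefficients are \<open>z i * e x i\<close>.\<close>
  have QR: "norm (Q x) \<le> r * Re (R x)" for x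
    unfolding Q_def R_def by (rule dom)
  define K where "K = (\<Sum>i\<in>J. \<Sum>j\<in>J. norm (z i) * norm (z j) * norm (P i j))"
  have RK: "norm (R x) \<le> K" for x
  proof -
    have "norm (R x) \<le> (\<Sum>i\<in>J. \<Sum>j\<in>J. norm ((z i * e x i) * cnj (z j * e x j) * P i j))"
      unfolding R_def by (rule order_trans[OF norm_sum sum_mono[OF norm_sum]])
    also have "\<dots> = K" unfolding K_def by (simp add: norm_mult e_def)
    finally show ?thesis .
  qed
  have RK': "r * Re (R x) \<le> \<bar>r\<bar> * K" for x
  proof -
    have "r * Re (R x) \<le> \<bar>r\<bar> * \<bar>Re (R x)\<bar>" by (metis abs_ge_self abs_mult)
    also have "\<dots> \<le> \<bar>r\<bar> * K"
      by (intro mult_left_mono order_trans[OF abs_Re_le_cmod RK]) auto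
    finally show ?thesis .
  qed
  have Qm [measurable]: "Q \<in> borel_measurable borel"
    unfolding Q_def complex_cnj_mult by measurable
  have Rm [measurable]: "R \<in> borel_measurable borel"
    unfolding R_def complex_cnj_mult by measurable
  have "norm (\<integral>x. std_normal_density x *\<^sub>R (cis (- (x * s / sqrt \<beta>)) * Q x) \<partial>lborel)
        \<le> theta_rate \<beta> C s * (\<integral>x. std_normal_density x * (r * Re (R x)) \<partial>lborel)"
    by (rule C[OF QR RK']) (simp_all add: Q_def R_def eper Qm[unfolded Q_def] Rm[unfolded R_def])
  moreover have "(\<integral>x. std_normal_density x *\<^sub>R (cis (- (x * s / sqrt \<beta>)) * Q x) \<partial>lborel)
     = (\<Sum>i\<in>J. \<Sum>j\<in>J. z i * cnj (z j)
        * (A i j * complex_of_real (exp (- ((real_of_int (d i - d j) - s)\<^sup>2 / (2 * \<beta>))))))"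
    unfolding Q_def by (rule wave)
  moreover have "(\<integral>x. std_normal_density x * (r * Re (R x)) \<partial>lborel) =
     r * Re (\<Sum>i\<in>J. \<Sum>j\<in>J. z i * cnj (z j)
        * (P i j * complex_of_real (exp (- ((real_of_int (d i - d j))\<^sup>2 / (2 * \<beta>))))))"
  proof -
    have iR: "integrable lborel (\<lambda>x. std_normal_density x *\<^sub>R R x)"
      by (rule integrable_std_normal_mult[OF Rm RK])
    have "(\<integral>x. std_normal_density x * (r * Re (R x)) \<partial>lborel)
        = r * (\<integral>x. Re (std_normal_density x *\<^sub>R R x) \<partial>lborel)"
      unfolding integral_mult_right_zero[symmetric]
      by (intro Bochner_Integration.integral_cong refl) (simp add: mult_ac)
    also have "(\<integral>x. Re (std_normal_density x *\<^sub>R R x) \<partial>lborel) = Re (\<integral>x. std_normal_density x *\<^sub>R R x \<partial>lborel)"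
      by (rule integral_Re[OF iR])
    also have "(\<integral>x. std_normal_density x *\<^sub>R R x \<partial>lborel) = (\<integral>x. std_normal_density x *\<^sub>R (cis (- (x * 0 / sqrt \<beta>)) * R x) \<partial>lborel)"
      by simp
    also have "\<dots> = (\<Sum>i\<in>J. \<Sum>j\<in>J. z i * cnj (z j)
        * (P i j * complex_of_real (exp (- ((real_of_int (d i - d j) - 0)\<^sup>2 / (2 * \<beta>))))))"
      unfolding R_def by (rule wave)
    finally show ?thesis by simp
  qed
  ultimately show ?thesis by (simp add: mult.assoc)
qed

text \<open>Induction over the edges from the constant kernel, whose form is the squared modulus of
  the sum of the coefficients. The middle claim is the case of one edge and one index; it later
  bounds \<open>error_M\<close> from above.\<close>

lemma gaussian_kernel_domination:
  assumes b: "\<beta> > 0"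
  obtains C where "C > 0"
    "\<And>s. exp (- (s\<^sup>2 / (2 * \<beta>))) \<le> theta_rate \<beta> C s"
    "\<And>(I :: 'e set) (J :: 'c set) D s. finite I \<Longrightarrow> finite J \<Longrightarrow>
      (\<Sum>i\<in>J. \<Sum>j\<in>J. \<Prod>e\<in>I. exp (- ((real_of_int (D i e - D j e) - s e)\<^sup>2 / (2 * \<beta>))))
      \<le> (\<Prod>e\<in>I. theta_rate \<beta> C (s e)) *
        (\<Sum>i\<in>J. \<Sum>j\<in>J. \<Prod>e\<in>I. exp (- ((real_of_int (D i e - D j e))\<^sup>2 / (2 * \<beta>))))"
proof -
  obtain C where C: "C > 0"
    "\<And>Q q s Kq. (\<And>x. norm (Q x) \<le> q x) \<Longrightarrow> (\<And>x::real. q x \<le> Kq) \<Longrightarrow>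
      Q \<in> borel_measurable borel \<Longrightarrow> q \<in> borel_measurable borel \<Longrightarrow>
      (\<And>x m::int. Q (x + 2 * pi * sqrt \<beta> * real_of_int m) = Q x) \<Longrightarrow>
      (\<And>x m::int. q (x + 2 * pi * sqrt \<beta> * real_of_int m) = q x) \<Longrightarrow>
      norm (\<integral>x. std_normal_density x *\<^sub>R (cis (- (x * s / sqrt \<beta>)) * Q x) \<partial>lborel)
        \<le> theta_rate \<beta> C s * (\<integral>x. std_normal_density x * q x \<partial>lborel)"
    using gaussian_twist_periodic_le[OF b] by blast
  define w where "w t k = exp (- ((real_of_int k - t)\<^sup>2 / (2 * \<beta>)))" for t k
  \<comment> \<open>Arbitrary complex \<open>z\<close> are needed for the induction, since each step
    twists the coefficients by phases; in the end only the constant 1 is inserted.\<close>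
  have main: "norm (\<Sum>i\<in>J. \<Sum>j\<in>J. z i * cnj (z j) * (\<Prod>e\<in>I. complex_of_real (w (s e) (D i e - D j e))))
      \<le> (\<Prod>e\<in>I. theta_rate \<beta> C (s e)) *
        Re (\<Sum>i\<in>J. \<Sum>j\<in>J. z i * cnj (z j) * (\<Prod>e\<in>I. complex_of_real (w 0 (D i e - D j e))))"
    if "finite I" "finite J" for I :: "'x set" and J :: "'y set" and D :: "'y \<Rightarrow> 'x \<Rightarrow> int" and s z
    using that(1)
  proof (induction I arbitrary: z)
    case empty
    have "(\<Sum>i\<in>J. \<Sum>j\<in>J. z i * cnj (z j)) = complex_of_real ((cmod (\<Sum>i\<in>J. z i))\<^sup>2)"
      by (simp only: sum_product[symmetric] complex_norm_square cnj_sum)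
    then show ?case by (simp add: norm_power)
  next
    case (insert e I)
    have "norm (\<Sum>i\<in>J. \<Sum>j\<in>J. z i * cnj (z j)
        * ((\<Prod>e\<in>I. complex_of_real (w (s e) (D i e - D j e)))
           * complex_of_real (exp (- ((real_of_int (D i e - D j e) - s e)\<^sup>2 / (2 * \<beta>))))))
      \<le> (theta_rate \<beta> C (s e) * (\<Prod>e\<in>I. theta_rate \<beta> C (s e))) * Re (\<Sum>i\<in>J. \<Sum>j\<in>J. z i * cnj (z j)
        * ((\<Prod>e\<in>I. complex_of_real (w 0 (D i e - D j e)))
           * complex_of_real (exp (- ((real_of_int (D i e - D j e))\<^sup>2 / (2 * \<beta>))))))"
      by (rule gaussian_kernel_step[OF b that(2) C(2) insert.IH])
    then show ?case using insert.hyps by (simp add: w_def mult_ac)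
  qed
  show ?thesis
  proof (rule that[OF C(1)])
    show "exp (- (s\<^sup>2 / (2 * \<beta>))) \<le> theta_rate \<beta> C s" for s
      using main[of "{()}" "{()}" "\<lambda>_. 1" "\<lambda>_. s" "\<lambda>_ _. 0"] by (simp add: w_def)
    fix I :: "'e set" and J :: "'c set" and D :: "'c \<Rightarrow> 'e \<Rightarrow> int" and s
    assume fin: "finite I" "finite J"
    define T where "T s = (\<Sum>i\<in>J. \<Sum>j\<in>J. \<Prod>e\<in>I. w (s e) (D i e - D j e))" for s
    have T: "(\<Sum>i\<in>J. \<Sum>j\<in>J. 1 * cnj 1 * (\<Prod>e\<in>I. complex_of_real (w (s e) (D i e - D j e)))) = complex_of_real (T s)" for s
      by (simp add: T_def)
    have "norm (complex_of_real (T s)) \<le> (\<Prod>e\<in>I. theta_rate \<beta> C (s e)) * Re (complex_of_real (T (\<lambda>_. 0)))"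
      using main[OF fin, of "\<lambda>_. 1" s D] unfolding T .
    then have "T s \<le> (\<Prod>e\<in>I. theta_rate \<beta> C (s e)) * T (\<lambda>_. 0)" by simp
    then show "(\<Sum>i\<in>J. \<Sum>j\<in>J. \<Prod>e\<in>I. exp (- ((real_of_int (D i e - D j e) - s e)\<^sup>2 / (2 * \<beta>))))
      \<le> (\<Prod>e\<in>I. theta_rate \<beta> C (s e)) *
        (\<Sum>i\<in>J. \<Sum>j\<in>J. \<Prod>e\<in>I. exp (- ((real_of_int (D i e - D j e))\<^sup>2 / (2 * \<beta>))))"
      by (simp add: T_def w_def)
  qed
qed

section \<open>The angle flow\<close>

text \<open>The edge from (x, y) to (x + 1, y) has as dual the vertical segment at abscissa x + 1/2
  between the ordinates y - 1/2 and y + 1/2. The angle at the origin is signed: positive for x \<ge>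
  0, negative for x < 0, hence always a flow away from the origin. Exchanging the arguments serves
  the vertical edges.\<close>

definition dual_angle :: "int \<Rightarrow> int \<Rightarrow> real" where
  "dual_angle x y = arctan ((real_of_int y + 1/2) / (real_of_int x + 1/2))
     - arctan ((real_of_int y - 1/2) / (real_of_int x + 1/2))"

lemma half_int_nonzero: "real_of_int x + 1/2 \<noteq> 0" "real_of_int x - 1/2 \<noteq> 0"
proof -
  have "real_of_int (2 * x + 1) \<noteq> 0" "real_of_int (2 * x - 1) \<noteq> 0"
    unfolding of_int_eq_0_iff by presburger+
  then show "real_of_int x + 1/2 \<noteq> 0" "real_of_int x - 1/2 \<noteq> 0" by simp_all
qed

lemma arctan_add_arctan_swap:
  assumes "a \<noteq> 0" "b \<noteq> 0"
  shows "arctan (a / b) + arctan (b / a) = sgn a * sgn b * pi / 2"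
proof -
  have "sgn (a / b) = sgn a * sgn b"
    using assms by (auto simp: sgn_if zero_less_divide_iff)
  moreover have "arctan (1 / (a / b)) = sgn (a / b) * pi / 2 - arctan (a / b)"
    by (rule Transcendental.arctan_inverse) (use assms in simp)
  moreover have "1 / (a / b) = b / a" by simp
  ultimately show ?thesis by (simp only:)
qed

lemma sgn_half_int_diff: "sgn (real_of_int x + 1/2) - sgn (real_of_int x - 1/2) = (if x = 0 then 2 else 0)"
proof -
  consider "x \<le> -1" | "x = 0" | "x \<ge> 1" by linarith
  then show ?thesis
  proof cases
    case 1
    then have "real_of_int x \<le> -1" by linarith
    then show ?thesis using 1 by simp
  next
    case 3
    then have "real_of_int x \<ge> 1" by linarith
    then show ?thesis using 3 by simp
  qed simp
qed

text \<open>The eight arctangents pair up at the four corners of the dual square around (x, y). Each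
  pair equals plus or minus pi/2 according to the quadrant of the corner, and the signs fail to
  cancel only when the square contains the origin.\<close>

lemma dual_angle_divergence:
  "dual_angle x y - dual_angle (x - 1) y + dual_angle y x - dual_angle (y - 1) x
    = (if x = 0 \<and> y = 0 then 2 * pi else 0)"
proof -
  define a where "a = real_of_int x + 1/2"
  define b where "b = real_of_int x - 1/2"
  define c where "c = real_of_int y + 1/2"
  define d where "d = real_of_int y - 1/2"
  have nz: "a \<noteq> 0" "b \<noteq> 0" "c \<noteq> 0" "d \<noteq> 0"
    using half_int_nonzero by (simp_all add: a_def b_def c_def d_def)
  have m: "real_of_int (x - 1) + 1/2 = b" "real_of_int (y - 1) + 1/2 = d" by (simp_all add: b_def d_def)
  have "dual_angle x y - dual_angle (x - 1) y + dual_angle y x - dual_angle (y - 1) x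
     = (arctan (c / a) + arctan (a / c)) - (arctan (d / a) + arctan (a / d))
       - (arctan (c / b) + arctan (b / c)) + (arctan (d / b) + arctan (b / d))"
    unfolding dual_angle_def m by (simp add: a_def b_def c_def d_def)
  also have "\<dots> = (sgn a - sgn b) * (sgn c - sgn d) * pi / 2"
    by (simp add: arctan_add_arctan_swap nz algebra_simps diff_divide_distrib add_divide_distrib)
  also have "\<dots> = (if x = 0 \<and> y = 0 then 2 * pi else 0)"
    unfolding a_def b_def c_def d_def sgn_half_int_diff by simp
  finally show ?thesis .
qed

section \<open>Sums of squares and cubes of the angles\<close>

definition arctan_sq_primitive :: "real \<Rightarrow> real" where
  "arctan_sq_primitive u = (u / (1 + u\<^sup>2) + arctan u) / 2"

lemma one_plus_sq_nonzero: "1 + (u::real)\<^sup>2 \<noteq> 0"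
  by (metis add_pos_nonneg less_irrefl zero_le_power2 zero_less_one)

lemma DERIV_arctan_sq_primitive:
  "(arctan_sq_primitive has_real_derivative (1 / (1 + u\<^sup>2))\<^sup>2) (at u)"
proof -
  have nz: "1 + u\<^sup>2 \<noteq> 0" by (rule one_plus_sq_nonzero)
  have d: "((\<lambda>u. 1 + u\<^sup>2) has_real_derivative 2 * u) (at u)"
    by (auto intro!: derivative_eq_intros)
  have "(arctan_sq_primitive has_real_derivative
      ((1 * (1 + u\<^sup>2) - u * (2 * u)) / ((1 + u\<^sup>2) * (1 + u\<^sup>2)) + inverse (1 + u\<^sup>2)) / 2) (at u)"
    unfolding arctan_sq_primitive_def[abs_def]
    by (intro DERIV_cdivide DERIV_add DERIV_divide d DERIV_ident DERIV_arctan nz)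
  also have "((1 * (1 + u\<^sup>2) - u * (2 * u)) / ((1 + u\<^sup>2) * (1 + u\<^sup>2)) + inverse (1 + u\<^sup>2)) / 2
    = (1 / (1 + u\<^sup>2))\<^sup>2"
  proof -
    define p where "p = 1 + u\<^sup>2"
    have p: "p \<noteq> 0" "u * (2 * u) = 2 * p - 2" using nz by (auto simp: p_def power2_eq_square)
    show ?thesis unfolding p_def[symmetric] p(2) using p(1) by (simp add: field_simps power2_eq_square)
  qed
  finally show ?thesis .
qed

lemma arctan_sq_primitive_mono: "u \<le> v \<Longrightarrow> arctan_sq_primitive u \<le> arctan_sq_primitive v"
  by (rule DERIV_nonneg_imp_nondecreasing) (use DERIV_arctan_sq_primitive in \<open>auto intro!: exI\<close>)

lemma arctan_sq_primitive_minus: "arctan_sq_primitive (- u) = - arctan_sq_primitive u"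
proof -
  have "arctan_sq_primitive (- u) = (- (u / (1 + u\<^sup>2)) + - arctan u) / 2"
    by (simp add: arctan_sq_primitive_def arctan_minus)
  also have "\<dots> = - arctan_sq_primitive u"
    unfolding arctan_sq_primitive_def minus_add_distrib[symmetric] by (rule minus_divide_left[symmetric])
  finally show ?thesis .
qed

text \<open>The function is odd and increasing with limit pi/4. Equivalently,
  \<open>(1 / (1 + u\<^sup>2))\<^sup>2\<close> has integral pi/2 over the line, which is the
  constant of the row sums.\<close>

lemma abs_arctan_sq_primitive_le: "\<bar>arctan_sq_primitive u\<bar> \<le> pi / 4"
proof -
  have lim: "(arctan_sq_primitive \<longlongrightarrow> pi / 4) at_top"
    unfolding arctan_sq_primitive_def[abs_def] by real_asymp
  have "arctan_sq_primitive u \<le> pi / 4" for u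
    by (rule tendsto_lowerbound[OF lim])
       (auto intro: arctan_sq_primitive_mono eventually_mono[OF eventually_ge_at_top[of u]])
  from this[of u] this[of "- u"] show ?thesis by (simp add: arctan_sq_primitive_minus)
qed

lemma arctan_increment_sq_le:
  fixes X t :: real
  assumes X: "X \<noteq> 0"
  shows "(arctan ((t + 1) / X) - arctan (t / X))\<^sup>2
    \<le> arctan_sq_primitive ((t + 1) / X) / X - arctan_sq_primitive (t / X) / X"
proof -
  \<comment> \<open>Cauchy-Schwarz for the derivative a of arctan (s / X), by integrating (a - l)^2 \<ge> 0.\<close>
  define l where "l = arctan ((t + 1) / X) - arctan (t / X)"
  define \<phi> where "\<phi> s = arctan_sq_primitive (s / X) / X - 2 * l * arctan (s / X) + l\<^sup>2 * s" for s
  have D: "(\<phi> has_real_derivative (1 / (1 + (s / X)\<^sup>2) / X - l)\<^sup>2) (at s)" for s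
  proof -
    have 1: "((\<lambda>s. arctan_sq_primitive (s / X) / X) has_real_derivative (1 / (1 + (s / X)\<^sup>2))\<^sup>2 * (1 / X) / X) (at s)"
      by (intro DERIV_cdivide DERIV_chain2[OF DERIV_arctan_sq_primitive] DERIV_ident)
    have 2: "((\<lambda>s. arctan (s / X)) has_real_derivative inverse (1 + (s / X)\<^sup>2) * (1 / X)) (at s)"
      by (intro DERIV_cdivide DERIV_chain2[OF DERIV_arctan] DERIV_ident)
    have "(\<phi> has_real_derivative
      ((1 / (1 + (s / X)\<^sup>2))\<^sup>2 * (1 / X) / X - 2 * l * (inverse (1 + (s / X)\<^sup>2) * (1 / X)) + l\<^sup>2 * 1)) (at s)"
      unfolding \<phi>_def[abs_def] by (intro DERIV_add DERIV_diff DERIV_cmult 1 2 DERIV_ident)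
    also have "((1 / (1 + (s / X)\<^sup>2))\<^sup>2 * (1 / X) / X - 2 * l * (inverse (1 + (s / X)\<^sup>2) * (1 / X)) + l\<^sup>2 * 1)
      = (1 / (1 + (s / X)\<^sup>2) / X - l)\<^sup>2"
      by (simp add: power2_diff inverse_eq_divide) (simp add: power2_eq_square)
    finally show ?thesis .
  qed
  have "\<phi> t \<le> \<phi> (t + 1)"
    by (rule DERIV_nonneg_imp_nondecreasing) (use D in \<open>auto intro!: exI\<close>)
  then have "2 * l * l - l\<^sup>2 \<le> arctan_sq_primitive ((t + 1) / X) / X - arctan_sq_primitive (t / X) / X"
    by (simp add: \<phi>_def l_def algebra_simps)
  then show ?thesis by (simp add: l_def[symmetric] power2_eq_square)
qed

text \<open>Each square is at most the integral of the squared angular density over the dual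
  segment. These integrals telescope along a line of parallel edges, and their total is bounded
  independently of the length of the line.\<close>

lemma sum_dual_angle_sq_le:
  assumes "finite Y"
  shows "(\<Sum>y\<in>Y. (dual_angle x y)\<^sup>2) \<le> pi / 2 / \<bar>real_of_int x + 1/2\<bar>"
proof -
  define X where "X = real_of_int x + 1/2"
  have X: "X \<noteq> 0" unfolding X_def by (rule half_int_nonzero)
  define h where "h y = arctan_sq_primitive ((real_of_int y - 1/2) / X) / X" for y
  have le: "(dual_angle x y)\<^sup>2 \<le> h (y + 1) - h y" for y
    using arctan_increment_sq_le[OF X, of "real_of_int y - 1/2"]
    by (simp add: dual_angle_def X_def[symmetric] h_def algebra_simps)
  obtain m :: nat where m: "Y \<subseteq> {- int m..<int m}"
  proof -
    assume *: "\<And>m. Y \<subseteq> {- int m..<int m} \<Longrightarrow> thesis"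
    have "\<bar>y\<bar> \<le> (\<Sum>y\<in>Y. \<bar>y\<bar>)" if "y \<in> Y" for y
      using that assms by (intro member_le_sum) auto
    then show thesis by (intro *[of "nat (\<Sum>y\<in>Y. \<bar>y\<bar>) + 1"]) force
  qed
  have tel: "(\<Sum>y\<in>{- int m..<int m}. h (y + 1) - h y) = h (int m) - h (- int m)" for m
  proof (induction m)
    case (Suc m)
    have "{- int (Suc m)..<int (Suc m)} = insert (- int (Suc m)) (insert (int m) {- int m..<int m})" by auto
    then show ?case using Suc by (simp add: algebra_simps)
  qed simp
  have "(\<Sum>y\<in>Y. (dual_angle x y)\<^sup>2) \<le> (\<Sum>y\<in>{- int m..<int m}. (dual_angle x y)\<^sup>2)"
    by (rule sum_mono2) (use m in auto)
  also have "\<dots> \<le> (\<Sum>y\<in>{- int m..<int m}. h (y + 1) - h y)" by (intro sum_mono le)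
  also have "\<dots> = h (int m) - h (- int m)" by (rule tel)
  also have "\<dots> \<le> \<bar>h (int m)\<bar> + \<bar>h (- int m)\<bar>" by linarith
  also have "\<dots> \<le> pi / 4 / \<bar>X\<bar> + pi / 4 / \<bar>X\<bar>"
    unfolding h_def abs_divide by (intro add_mono divide_right_mono abs_arctan_sq_primitive_le) auto
  finally show ?thesis by (simp add: X_def)
qed

lemma abs_arctan_diff_le: "\<bar>arctan a - arctan b\<bar> \<le> \<bar>a - b\<bar>"
proof -
  have mono: "arctan v - arctan u \<le> v - u" if "u \<le> v" for u v
  proof -
    have "u - arctan u \<le> v - arctan v"
    proof (rule DERIV_nonneg_imp_nondecreasing[OF that])
      fix s
      have "((\<lambda>x. x - arctan x) has_real_derivative (1 - inverse (1 + s\<^sup>2))) (at s)"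
        by (intro DERIV_diff DERIV_ident DERIV_arctan)
      moreover have "inverse (1 + s\<^sup>2) \<le> 1" by (simp add: field_simps add_pos_nonneg)
      ultimately show "\<exists>y. ((\<lambda>x. x - arctan x) has_real_derivative y) (at s) \<and> 0 \<le> y"
        by (intro exI[of _ "1 - inverse (1 + s\<^sup>2)"]) auto
    qed
    then show ?thesis by simp
  qed
  show ?thesis
    using mono[of a b] mono[of b a] arctan_le_iff[of a b] arctan_le_iff[of b a] by (cases "a \<le> b") auto
qed

lemma abs_dual_angle_le: "\<bar>dual_angle x y\<bar> \<le> 1 / \<bar>real_of_int x + 1/2\<bar>"
proof -
  have "(real_of_int y + 1/2) / (real_of_int x + 1/2) - (real_of_int y - 1/2) / (real_of_int x + 1/2) = 1 / (real_of_int x + 1/2)"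
    by (simp add: diff_divide_distrib[symmetric])
  then show ?thesis
    unfolding dual_angle_def using abs_arctan_diff_le by (metis abs_divide abs_one)
qed

text \<open>One factor is at most the inverse distance of the line of dual edges, and the other two
  are summed as squares; the result is summable over all lines.\<close>

lemma sum_dual_angle_cube_le:
  assumes "finite Y"
  shows "(\<Sum>y\<in>Y. \<bar>dual_angle x y\<bar> ^ 3) \<le> pi / 2 / \<bar>real_of_int x + 1/2\<bar>\<^sup>2"
proof -
  have "(\<Sum>y\<in>Y. \<bar>dual_angle x y\<bar> ^ 3) \<le> (\<Sum>y\<in>Y. (1 / \<bar>real_of_int x + 1/2\<bar>) * (dual_angle x y)\<^sup>2)"
  proof (rule sum_mono)
    fix y
    have "\<bar>dual_angle x y\<bar> ^ 3 = \<bar>dual_angle x y\<bar> * (dual_angle x y)\<^sup>2"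
      by (simp add: power3_eq_cube power2_eq_square)
    also have "\<dots> \<le> (1 / \<bar>real_of_int x + 1/2\<bar>) * (dual_angle x y)\<^sup>2"
      by (intro mult_right_mono abs_dual_angle_le) auto
    finally show "\<bar>dual_angle x y\<bar> ^ 3 \<le> (1 / \<bar>real_of_int x + 1/2\<bar>) * (dual_angle x y)\<^sup>2" .
  qed
  also have "\<dots> = (1 / \<bar>real_of_int x + 1/2\<bar>) * (\<Sum>y\<in>Y. (dual_angle x y)\<^sup>2)"
    by (simp add: sum_distrib_left)
  also have "\<dots> \<le> (1 / \<bar>real_of_int x + 1/2\<bar>) * (pi / 2 / \<bar>real_of_int x + 1/2\<bar>)"
    by (intro mult_left_mono sum_dual_angle_sq_le assms) auto
  also have "\<dots> = pi / 2 / \<bar>real_of_int x + 1/2\<bar>\<^sup>2"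
    unfolding power2_eq_square by (simp only: times_divide_times_eq divide_divide_eq_left mult_1 mult.assoc)
      (simp only: mult.left_commute mult.commute)
  finally show ?thesis .
qed

section \<open>Sums over half-integers\<close>

lemma sum_symmetric_half_int:
  "(\<Sum>x\<in>{- int N..<int N}. f \<bar>real_of_int x + 1/2\<bar>) = 2 * (\<Sum>k<N. f (real k + 1/2) :: real)"
proof (induction N)
  case (Suc N)
  have I: "{- int (Suc N)..<int (Suc N)} = insert (- int (Suc N)) (insert (int N) {- int N..<int N})" by auto
  have "\<bar>real_of_int (- int (Suc N)) + 1/2\<bar> = real N + 1/2" "\<bar>real_of_int (int N) + 1/2\<bar> = real N + 1/2" by auto
  then show ?case using Suc unfolding I by simp
qed simp

text \<open>The constant 3 covers the first two terms 2 + 2/3; every further term is below an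
  increment of the logarithm.\<close>

lemma sum_inverse_half_int_le:
  "N \<ge> 1 \<Longrightarrow> (\<Sum>k<Suc N. 1 / (real k + 1/2)) \<le> 3 + ln (real N)"
proof (induction N rule: dec_induct)
  case base
  then show ?case by simp
next
  case (step N)
  have N: "real N \<ge> 1" using step by simp
  have "ln (real N / (real N + 1)) \<le> real N / (real N + 1) - 1" using N by (intro ln_le_minus_one) auto
  also have "\<dots> = - (1 / (real N + 1))" using N by (simp add: field_simps)
  finally have "1 / (real N + 1) \<le> ln (real N + 1) - ln (real N)" using N by (simp add: ln_div)
  moreover have "1 / (real N + 1 + 1/2) \<le> 1 / (real N + 1)" using N by (intro divide_left_mono) auto
  moreover have "(\<Sum>k<Suc (Suc N). 1 / (real k + 1/2)) = (\<Sum>k<Suc N. 1 / (real k + 1/2)) + 1 / (real N + 1 + 1/2)"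
    by (simp add: add_ac)
  moreover have "real (Suc N) = real N + 1" by simp
  ultimately show ?case using step.IH by (simp only:)
qed

text \<open>The induction carries the correction \<open>1 / (real N + 1)\<close>, which telescopes
  because (N + 3/2)^2 exceeds (N + 1)(N + 2). The first term is 4 = 5 - 1.\<close>

lemma sum_inverse_sq_half_int_le: "(\<Sum>k<N. 1 / (real k + 1/2)\<^sup>2) \<le> 5"
proof -
  have "(\<Sum>k<Suc N. 1 / (real k + 1/2)\<^sup>2) \<le> 5 - 1 / (real N + 1)" for N
  proof (induction N)
    case 0
    then show ?case by (simp add: power2_eq_square)
  next
    case (Suc N)
    have "1 / (real N + 1 + 1/2)\<^sup>2 \<le> 1 / ((real N + 1) * (real N + 2))"
    proof (rule divide_left_mono)
      show "(real N + 1) * (real N + 2) \<le> (real N + 1 + 1/2)\<^sup>2"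
        by (simp add: power2_eq_square algebra_simps)
      show "0 < (real N + 1 + 1/2)\<^sup>2 * ((real N + 1) * (real N + 2))"
        by (intro mult_pos_pos zero_less_power) auto
    qed simp
    also have "\<dots> = 1 / (real N + 1) - 1 / (real N + 2)" by (simp add: field_simps)
    finally have "1 / (real N + 1 + 1/2)\<^sup>2 \<le> 1 / (real N + 1) - 1 / (real N + 2)" .
    moreover have "(\<Sum>k<Suc (Suc N). 1 / (real k + 1/2)\<^sup>2) = (\<Sum>k<Suc N. 1 / (real k + 1/2)\<^sup>2) + 1 / (real N + 1 + 1/2)\<^sup>2"
      by (simp add: add_ac)
    moreover have "real (Suc N) + 1 = real N + 2" by simp
    ultimately show ?case using Suc by (simp only:)
  qed
  from this[of N] have "(\<Sum>k<Suc N. 1 / (real k + 1/2)\<^sup>2) \<le> 5"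
    by (smt (verit) divide_nonneg_nonneg of_nat_0_le_iff)
  moreover have "(\<Sum>k<N. 1 / (real k + 1/2)\<^sup>2) \<le> (\<Sum>k<Suc N. 1 / (real k + 1/2)\<^sup>2)" by simp
  ultimately show ?thesis by linarith
qed

text \<open>An edge to Infty leaving the box is indexed by the lattice edge it replaces; a corner site
  then carries two such indices, which accounts for its two parallel edges.\<close>

definition edge_index :: "nat \<Rightarrow> (int \<times> int + int \<times> int) set" where
  "edge_index n = ({- int n - 1..int n} \<times> {- int n..int n}) <+> ({- int n..int n} \<times> {- int n - 1..int n})"

fun edge_diff :: "(vertex \<Rightarrow> int) \<Rightarrow> int \<times> int + int \<times> int \<Rightarrow> int" where
  "edge_diff \<Psi> (Inl (x, y)) = \<Psi> (Site (x, y)) - \<Psi> (Site (x + 1, y))"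
| "edge_diff \<Psi> (Inr (x, y)) = \<Psi> (Site (x, y)) - \<Psi> (Site (x, y + 1))"

fun angle_flow :: "int \<times> int \<Rightarrow> int \<times> int + int \<times> int \<Rightarrow> real" where
  "angle_flow (p, q) (Inl (x, y)) = dual_angle (x - p) (y - q) / (2 * pi)"
| "angle_flow (p, q) (Inr (x, y)) = dual_angle (y - q) (x - p) / (2 * pi)"

lemma finite_edge_index [simp]: "finite (edge_index n)"
  by (simp add: edge_index_def)

lemma sum_edge_index:
  fixes f :: "int \<times> int + int \<times> int \<Rightarrow> 'b::comm_monoid_add"
  shows "(\<Sum>e\<in>edge_index n. f e) = (\<Sum>y\<in>{- int n..int n}. \<Sum>x\<in>{- int n - 1..int n}. f (Inl (x, y)))
     + (\<Sum>x\<in>{- int n..int n}. \<Sum>y\<in>{- int n - 1..int n}. f (Inr (x, y)))"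
proof -
  let ?I = "{- int n..int n}" and ?J = "{- int n - 1..int n}"
  have "(\<Sum>e\<in>edge_index n. f e) = (\<Sum>z\<in>?J \<times> ?I. f (Inl z)) + (\<Sum>z\<in>?I \<times> ?J. f (Inr z))"
    unfolding edge_index_def by (subst sum.Plus) auto
  also have "(\<Sum>z\<in>?J \<times> ?I. f (Inl z)) = (\<Sum>x\<in>?J. \<Sum>y\<in>?I. f (Inl (x, y)))"
    by (simp add: sum.cartesian_product case_prod_beta)
  also have "\<dots> = (\<Sum>y\<in>?I. \<Sum>x\<in>?J. f (Inl (x, y)))" by (rule sum.swap)
  also have "(\<Sum>z\<in>?I \<times> ?J. f (Inr z)) = (\<Sum>x\<in>?I. \<Sum>y\<in>?J. f (Inr (x, y)))"
    by (simp add: sum.cartesian_product case_prod_beta)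
  finally show ?thesis .
qed

section \<open>Energy and heights in terms of lattice edges\<close>

lemma configs_outside: "\<Psi> \<in> configs n \<Longrightarrow> p \<notin> grid_box n \<Longrightarrow> \<Psi> (Site p) = 0"
  by (auto simp: configs_def verts_def)

text \<open>A configuration vanishes outside the box as it does at \<open>Infty\<close>, so an edge
  to \<open>Infty\<close> has the same gradient as the lattice edge leaving the box. For
  \<open>n \<ge> 1\<close> opposite sides of the box are distinct.\<close>

lemma dirichlet_energy_edge_index:
  assumes \<Psi>: "\<Psi> \<in> configs n" and n: "n \<ge> 1"
  shows "dirichlet_energy n \<Psi> = (\<Sum>e\<in>edge_index n. (real_of_int (edge_diff \<Psi> e))\<^sup>2)"
proof -
  define g :: "vertex \<times> vertex \<Rightarrow> real" where "g = (\<lambda>(u, v). (real_of_int (\<Psi> u - \<Psi> v))\<^sup>2)"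
  define F where "F x y = real_of_int (\<Psi> (Site (x, y)))" for x y
  let ?I = "{- int n..int n}"
  define H where "H = {(Site (x, y), Site (x + 1, y)) | x y. (x, y) \<in> grid_box n \<and> (x + 1, y) \<in> grid_box n}"
  define V where "V = {(Site (x, y), Site (x, y + 1)) | x y. (x, y) \<in> grid_box n \<and> (x, y + 1) \<in> grid_box n}"
  have F0: "F x y = 0" if "(x, y) \<notin> grid_box n" for x y
    using configs_outside[OF \<Psi> that] by (simp add: F_def)
  have I0: "\<Psi> Infty = 0" using \<Psi> by (simp add: configs_def)
  have E: "dirichlet_energy n \<Psi> = sum g H + sum g V + sum g ((\<lambda>p. (Site p, Infty)) ` box_boundary n)
      + sum g ((\<lambda>p. (Site p, Infty)) ` box_corners n)"
    unfolding dirichlet_energy_def edges_def H_def V_def g_def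
    by (simp add: sum_unfold_sum_mset)
  have H: "sum g H = (\<Sum>y\<in>?I. \<Sum>x\<in>{- int n..int n - 1}. (F x y - F (x + 1) y)\<^sup>2)"
  proof -
    have "H = (\<lambda>(y, x). (Site (x, y), Site (x + 1, y))) ` (?I \<times> {- int n..int n - 1})"
      unfolding H_def grid_box_def by (auto simp: image_iff)
    then have "sum g H = (\<Sum>(y, x)\<in>?I \<times> {- int n..int n - 1}. g (Site (x, y), Site (x + 1, y)))"
      by (simp add: sum.reindex inj_on_def case_prod_unfold)
    then show ?thesis by (simp add: sum.cartesian_product g_def F_def)
  qed
  have V: "sum g V = (\<Sum>x\<in>?I. \<Sum>y\<in>{- int n..int n - 1}. (F x y - F x (y + 1))\<^sup>2)"
  proof -
    have "V = (\<lambda>(x, y). (Site (x, y), Site (x, y + 1))) ` (?I \<times> {- int n..int n - 1})"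
      unfolding V_def grid_box_def by (auto simp: image_iff)
    then have "sum g V = (\<Sum>(x, y)\<in>?I \<times> {- int n..int n - 1}. g (Site (x, y), Site (x, y + 1)))"
      by (simp add: sum.reindex inj_on_def case_prod_unfold)
    then show ?thesis by (simp add: sum.cartesian_product g_def F_def)
  qed
  have R: "sum g ((\<lambda>p. (Site p, Infty)) ` A) = (\<Sum>(x, y)\<in>A. (F x y)\<^sup>2)" for A
    by (subst sum.reindex) (auto simp: inj_on_def g_def F_def I0 intro!: sum.cong)
  define X where "X = {- int n, int n} \<times> ?I"
  define Y where "Y = ?I \<times> {- int n, int n}"
  \<comment> \<open>The vertical sides \<open>X\<close> and the horizontal sides \<open>Y\<close>
    share the corners, and the two families of edges to \<open>Infty\<close> are indexed by union
    and intersection; together they count each side in full.\<close>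
  have XY: "box_boundary n = X \<union> Y" "box_corners n = X \<inter> Y"
    unfolding box_boundary_def box_corners_def X_def Y_def grid_box_def by auto
  have "sum g ((\<lambda>p. (Site p, Infty)) ` box_boundary n) + sum g ((\<lambda>p. (Site p, Infty)) ` box_corners n)
     = (\<Sum>(x, y)\<in>X. (F x y)\<^sup>2) + (\<Sum>(x, y)\<in>Y. (F x y)\<^sup>2)"
    unfolding R XY by (rule sum.union_inter) (auto simp: X_def Y_def)
  also have "(\<Sum>(x, y)\<in>X. (F x y)\<^sup>2) = (\<Sum>y\<in>?I. (F (- int n) y)\<^sup>2 + (F (int n) y)\<^sup>2)"
    unfolding X_def using n by (simp add: sum.cartesian_product[symmetric] sum.distrib)
  also have "(\<Sum>(x, y)\<in>Y. (F x y)\<^sup>2) = (\<Sum>x\<in>?I. (F x (- int n))\<^sup>2 + (F x (int n))\<^sup>2)"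
    unfolding Y_def using n by (simp add: sum.cartesian_product[symmetric])
  finally have E2: "dirichlet_energy n \<Psi> =
     (\<Sum>y\<in>?I. (\<Sum>x\<in>{- int n..int n - 1}. (F x y - F (x + 1) y)\<^sup>2) + ((F (- int n) y)\<^sup>2 + (F (int n) y)\<^sup>2))
   + (\<Sum>x\<in>?I. (\<Sum>y\<in>{- int n..int n - 1}. (F x y - F x (y + 1))\<^sup>2) + ((F x (- int n))\<^sup>2 + (F x (int n))\<^sup>2))"
    unfolding E H V by (simp add: sum.distrib)
  have J: "{- int n - 1..int n} = insert (- int n - 1) (insert (int n) {- int n..int n - 1})" by auto
  have row: "(\<Sum>x\<in>{- int n - 1..int n}. (f x - f (x + 1))\<^sup>2)
      = (\<Sum>x\<in>{- int n..int n - 1}. (f x - f (x + 1))\<^sup>2) + ((f (- int n))\<^sup>2 + (f (int n))\<^sup>2)"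
    if "f (- int n - 1) = 0" "f (int n + 1) = 0" for f :: "int \<Rightarrow> real"
    unfolding J using that by simp
  show ?thesis
    unfolding E2 sum_edge_index
    by (intro arg_cong2[of _ _ _ _ "(+)"] sum.cong refl)
      (simp_all add: F_def[symmetric] row[of "\<lambda>x. F x _", symmetric] row[of "F _", symmetric] F0 grid_box_def)
qed

lemma summation_by_parts_int:
  fixes a f :: "int \<Rightarrow> real"
  assumes "f (- int n - 1) = 0" "f (int n + 1) = 0"
  shows "(\<Sum>x\<in>{- int n - 1..int n}. a x * (f x - f (x + 1))) = (\<Sum>x\<in>{- int n..int n}. f x * (a x - a (x - 1)))"
proof -
  have J: "{- int n - 1..int n} = insert (- int n - 1) {- int n..int n}" by auto
  have 1: "(\<Sum>x\<in>{- int n - 1..int n}. a x * f x) = (\<Sum>x\<in>{- int n..int n}. a x * f x)"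
    unfolding J using assms by simp
  have "(\<Sum>x\<in>{- int n - 1..int n}. a x * f (x + 1)) = (\<Sum>x\<in>{- int n..int n + 1}. a (x - 1) * f x)"
    by (rule sum.reindex_bij_witness[where i = "\<lambda>x. x - 1" and j = "\<lambda>x. x + 1"]) auto
  also have "{- int n..int n + 1} = insert (int n + 1) {- int n..int n}" by auto
  finally have 2: "(\<Sum>x\<in>{- int n - 1..int n}. a x * f (x + 1)) = (\<Sum>x\<in>{- int n..int n}. a (x - 1) * f x)"
    using assms by simp
  show ?thesis
    unfolding right_diff_distrib sum_subtractf 1 2 by (simp add: mult.commute)
qed

text \<open>Summation by parts moves the gradient onto the flow, whose divergence is a unit source
  at \<open>v\<close>. The flow needs no boundary condition because the heights vanish outside the
  box.\<close>

lemma angle_flow_represents: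
  assumes \<Psi>: "\<Psi> \<in> configs n" and v: "v \<in> grid_box n"
  shows "(\<Sum>e\<in>edge_index n. angle_flow v e * real_of_int (edge_diff \<Psi> e)) = real_of_int (\<Psi> (Site v))"
proof -
  obtain p q where pq: "v = (p, q)" by (cases v)
  let ?I = "{- int n..int n}"
  define F where "F x y = real_of_int (\<Psi> (Site (x, y)))" for x y
  have F0: "F x y = 0" if "(x, y) \<notin> grid_box n" for x y
    using configs_outside[OF \<Psi> that] by (simp add: F_def)
  define a where "a x y = dual_angle (x - p) (y - q) / (2 * pi)" for x y
  define b where "b x y = dual_angle (y - q) (x - p) / (2 * pi)" for x y
  have "(\<Sum>e\<in>edge_index n. angle_flow v e * real_of_int (edge_diff \<Psi> e))
    = (\<Sum>y\<in>?I. \<Sum>x\<in>{- int n - 1..int n}. a x y * (F x y - F (x + 1) y))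
     + (\<Sum>x\<in>?I. \<Sum>y\<in>{- int n - 1..int n}. b x y * (F x y - F x (y + 1)))"
    unfolding sum_edge_index by (simp add: pq a_def b_def F_def)
  also have "(\<Sum>y\<in>?I. \<Sum>x\<in>{- int n - 1..int n}. a x y * (F x y - F (x + 1) y))
      = (\<Sum>y\<in>?I. \<Sum>x\<in>?I. F x y * (a x y - a (x - 1) y))"
    by (intro sum.cong refl summation_by_parts_int) (auto intro!: F0 simp: grid_box_def)
  also have "\<dots> = (\<Sum>x\<in>?I. \<Sum>y\<in>?I. F x y * (a x y - a (x - 1) y))" by (rule sum.swap)
  also have "(\<Sum>x\<in>?I. \<Sum>y\<in>{- int n - 1..int n}. b x y * (F x y - F x (y + 1)))
      = (\<Sum>x\<in>?I. \<Sum>y\<in>?I. F x y * (b x y - b x (y - 1)))"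
    by (intro sum.cong refl summation_by_parts_int) (auto intro!: F0 simp: grid_box_def)
  also have "(\<Sum>x\<in>?I. \<Sum>y\<in>?I. F x y * (a x y - a (x - 1) y)) + (\<Sum>x\<in>?I. \<Sum>y\<in>?I. F x y * (b x y - b x (y - 1)))
      = (\<Sum>x\<in>?I. \<Sum>y\<in>?I. F x y * (a x y - a (x - 1) y + b x y - b x (y - 1)))"
    by (simp add: sum.distrib[symmetric] algebra_simps)
  also have "\<dots> = (\<Sum>x\<in>?I. \<Sum>y\<in>?I. if y = q then (if x = p then F x y else 0) else 0)"
  proof (intro sum.cong refl)
    fix x y
    have "a x y - a (x - 1) y + b x y - b x (y - 1)
      = (dual_angle (x - p) (y - q) - dual_angle (x - p - 1) (y - q)
         + dual_angle (y - q) (x - p) - dual_angle (y - q - 1) (x - p)) / (2 * pi)"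
      by (simp add: a_def b_def add_divide_distrib diff_divide_distrib algebra_simps)
    also have "\<dots> = (if x = p \<and> y = q then 1 else 0)"
      unfolding dual_angle_divergence by simp
    finally show "F x y * (a x y - a (x - 1) y + b x y - b x (y - 1)) = (if y = q then (if x = p then F x y else 0) else 0)"
      by simp
  qed
  also have "\<dots> = F p q" using v by (simp add: pq grid_box_def)
  finally show ?thesis by (simp add: F_def pq)
qed

text \<open>Seen from a site of the box, all columns lie in a window of radius
  \<open>2 * n + 1\<close>; this is the origin of \<open>ln (2 * real n)\<close> below.\<close>

lemma sum_shifted_half_int_le:
  assumes p: "\<bar>p\<bar> \<le> int n" and f: "\<And>u. f u \<ge> (0::real)"
  shows "(\<Sum>x\<in>{- int n - 1..int n}. f \<bar>real_of_int (x - p) + 1/2\<bar>) \<le> 2 * (\<Sum>k<Suc (2 * n). f (real k + 1/2))"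
proof -
  have "(\<Sum>x\<in>{- int n - 1..int n}. f \<bar>real_of_int (x - p) + 1/2\<bar>)
      = (\<Sum>x\<in>{- int n - 1 - p..int n - p}. f \<bar>real_of_int x + 1/2\<bar>)"
    by (rule sum.reindex_bij_witness[where i = "\<lambda>x. x + p" and j = "\<lambda>x. x - p"]) auto
  also have "\<dots> \<le> (\<Sum>x\<in>{- int (Suc (2 * n))..<int (Suc (2 * n))}. f \<bar>real_of_int x + 1/2\<bar>)"
    by (rule sum_mono2) (use p f in auto)
  also have "\<dots> = 2 * (\<Sum>k<Suc (2 * n). f (real k + 1/2))" by (rule sum_symmetric_half_int)
  finally show ?thesis .
qed

text \<open>A line at distance X contributes at most pi/(2 X), and the half-integer distances count
  at most twice. The two edge directions together give 2 pi over (2 pi)^2.\<close>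

lemma sum_angle_flow_sq_le:
  assumes v: "v \<in> grid_box n" and n: "n \<ge> 1"
  shows "(\<Sum>e\<in>edge_index n. (angle_flow v e)\<^sup>2) \<le> (3 + ln (2 * real n)) / (2 * pi)"
proof -
  obtain p q where pq: "v = (p, q)" by (cases v)
  have b: "\<bar>p\<bar> \<le> int n" "\<bar>q\<bar> \<le> int n" using v by (auto simp: pq grid_box_def)
  let ?I = "{- int n..int n}" and ?J = "{- int n - 1..int n}"
  have row: "(\<Sum>x\<in>?J. \<Sum>y\<in>?I. (dual_angle (x - r) (y - s))\<^sup>2) \<le> pi * (3 + ln (2 * real n))"
    if r: "\<bar>r\<bar> \<le> int n" for r s
  proof -
    have "(\<Sum>x\<in>?J. \<Sum>y\<in>?I. (dual_angle (x - r) (y - s))\<^sup>2) \<le> (\<Sum>x\<in>?J. pi / 2 / \<bar>real_of_int (x - r) + 1/2\<bar>)"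
    proof (rule sum_mono)
      fix x
      have "(\<Sum>y\<in>?I. (dual_angle (x - r) (y - s))\<^sup>2) = (\<Sum>y\<in>(\<lambda>y. y - s) ` ?I. (dual_angle (x - r) y)\<^sup>2)"
        by (subst sum.reindex) (auto simp: inj_on_def)
      also have "\<dots> \<le> pi / 2 / \<bar>real_of_int (x - r) + 1/2\<bar>" by (rule sum_dual_angle_sq_le) auto
      finally show "(\<Sum>y\<in>?I. (dual_angle (x - r) (y - s))\<^sup>2) \<le> pi / 2 / \<bar>real_of_int (x - r) + 1/2\<bar>" .
    qed
    \<comment> \<open>The doubled absolute value displays the summand as \<open>f\<close> of an
      absolute value with \<open>f u = 1 / \<bar>u\<bar>\<close>, which is nonnegative at every real
      \<open>u\<close>, as \<open>sum_shifted_half_int_le\<close> demands.\<close>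
    also have "\<dots> = pi / 2 * (\<Sum>x\<in>?J. 1 / \<bar>\<bar>real_of_int (x - r) + 1/2\<bar>\<bar>)"
      by (simp add: sum_distrib_left)
    also have "\<dots> \<le> pi / 2 * (2 * (\<Sum>k<Suc (2 * n). 1 / \<bar>real k + 1/2\<bar>))"
      by (intro mult_left_mono sum_shifted_half_int_le r) auto
    also have "(\<Sum>k<Suc (2 * n). 1 / \<bar>real k + 1/2\<bar>) = (\<Sum>k<Suc (2 * n). 1 / (real k + 1/2))"
      by (intro sum.cong refl) simp
    also have "\<dots> \<le> 3 + ln (2 * real n)" using n sum_inverse_half_int_le[of "2 * n"] by simp
    also have "pi / 2 * (2 * (3 + ln (2 * real n))) = pi * (3 + ln (2 * real n))" by simp
    finally show ?thesis by simp
  qed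
  have "(\<Sum>e\<in>edge_index n. (angle_flow v e)\<^sup>2) =
     ((\<Sum>x\<in>?J. \<Sum>y\<in>?I. (dual_angle (x - p) (y - q))\<^sup>2) + (\<Sum>y\<in>?J. \<Sum>x\<in>?I. (dual_angle (y - q) (x - p))\<^sup>2)) / (2 * pi)\<^sup>2"
    unfolding sum_edge_index pq angle_flow.simps power_divide sum.swap[of _ ?I ?J]
    by (simp add: sum_divide_distrib[symmetric] add_divide_distrib)
  also have "\<dots> \<le> (pi * (3 + ln (2 * real n)) + pi * (3 + ln (2 * real n))) / (2 * pi)\<^sup>2"
    by (intro divide_right_mono add_mono row b) auto
  also have "\<dots> = (3 + ln (2 * real n)) / (2 * pi)" by (simp add: power2_eq_square field_simps)
  finally show ?thesis .
qed

lemma sum_angle_flow_cube_le: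
  assumes v: "v \<in> grid_box n"
  shows "(\<Sum>e\<in>edge_index n. \<bar>angle_flow v e\<bar> ^ 3) \<le> 10 * pi / (2 * pi) ^ 3"
proof -
  obtain p q where pq: "v = (p, q)" by (cases v)
  have b: "\<bar>p\<bar> \<le> int n" "\<bar>q\<bar> \<le> int n" using v by (auto simp: pq grid_box_def)
  let ?I = "{- int n..int n}" and ?J = "{- int n - 1..int n}"
  have row: "(\<Sum>x\<in>?J. \<Sum>y\<in>?I. \<bar>dual_angle (x - r) (y - s)\<bar> ^ 3) \<le> 5 * pi"
    if r: "\<bar>r\<bar> \<le> int n" for r s
  proof -
    have "(\<Sum>x\<in>?J. \<Sum>y\<in>?I. \<bar>dual_angle (x - r) (y - s)\<bar> ^ 3) \<le> (\<Sum>x\<in>?J. pi / 2 / \<bar>real_of_int (x - r) + 1/2\<bar>\<^sup>2)"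
    proof (rule sum_mono)
      fix x
      have "(\<Sum>y\<in>?I. \<bar>dual_angle (x - r) (y - s)\<bar> ^ 3) = (\<Sum>y\<in>(\<lambda>y. y - s) ` ?I. \<bar>dual_angle (x - r) y\<bar> ^ 3)"
        by (subst sum.reindex) (auto simp: inj_on_def)
      also have "\<dots> \<le> pi / 2 / \<bar>real_of_int (x - r) + 1/2\<bar>\<^sup>2" by (rule sum_dual_angle_cube_le) auto
      finally show "(\<Sum>y\<in>?I. \<bar>dual_angle (x - r) (y - s)\<bar> ^ 3) \<le> pi / 2 / \<bar>real_of_int (x - r) + 1/2\<bar>\<^sup>2" .
    qed
    also have "\<dots> = pi / 2 * (\<Sum>x\<in>?J. 1 / \<bar>real_of_int (x - r) + 1/2\<bar>\<^sup>2)"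
      by (simp add: sum_distrib_left)
    also have "\<dots> \<le> pi / 2 * (2 * (\<Sum>k<Suc (2 * n). 1 / (real k + 1/2)\<^sup>2))"
      by (intro mult_left_mono sum_shifted_half_int_le[where f = "\<lambda>u. 1 / u\<^sup>2"] r) auto
    also have "\<dots> \<le> pi / 2 * (2 * 5)"
      by (intro mult_left_mono sum_inverse_sq_half_int_le) auto
    finally show ?thesis by simp
  qed
  have "(\<Sum>e\<in>edge_index n. \<bar>angle_flow v e\<bar> ^ 3) =
     ((\<Sum>x\<in>?J. \<Sum>y\<in>?I. \<bar>dual_angle (x - p) (y - q)\<bar> ^ 3) + (\<Sum>y\<in>?J. \<Sum>x\<in>?I. \<bar>dual_angle (y - q) (x - p)\<bar> ^ 3)) / (2 * pi) ^ 3"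
    unfolding sum_edge_index pq angle_flow.simps abs_divide power_divide sum.swap[of _ ?I ?J]
    by (simp add: sum_divide_distrib[symmetric] add_divide_distrib)
  also have "\<dots> \<le> (5 * pi + 5 * pi) / (2 * pi) ^ 3"
    by (intro divide_right_mono add_mono row b) auto
  finally show ?thesis by simp
qed

section \<open>Exponential moments and the maximum\<close>

text \<open>Summed over \<open>configs n\<close> this is T(s) of the overview; the zero shift gives
  the Gibbs weight itself.\<close>

definition tilted_weight :: "nat \<Rightarrow> real \<Rightarrow> (int \<times> int + int \<times> int \<Rightarrow> real) \<Rightarrow> (vertex \<Rightarrow> int) \<Rightarrow> real" where
  "tilted_weight n \<beta> s \<Psi> = (\<Prod>e\<in>edge_index n. exp (- ((real_of_int (edge_diff \<Psi> e) - s e)\<^sup>2 / (2 * \<beta>))))"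

lemma tilted_weight_pos: "tilted_weight n \<beta> s \<Psi> > 0"
  unfolding tilted_weight_def by (intro prod_pos) auto

lemma tilted_weight_zero:
  assumes "\<Psi> \<in> configs n" "n \<ge> 1"
  shows "tilted_weight n \<beta> (\<lambda>_. 0) \<Psi> = exp (- (1 / \<beta> / 2 * dirichlet_energy n \<Psi>))"
  unfolding tilted_weight_def dirichlet_energy_edge_index[OF assms]
  by (simp add: exp_sum[symmetric] sum_negf sum_divide_distrib mult.commute)

lemma edge_diff_diff: "edge_diff (\<lambda>x. \<Psi> x - \<Phi> x) e = edge_diff \<Psi> e - edge_diff \<Phi> e"
  by (cases e) auto

text \<open>The kernel domination compares sums over pairs of heights in a finite box. Such a sum is
  asymptotically the cardinality of the box times a sum over all differences, since boxes of
  heights are Foelner sets.\<close>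

lemma tilted_weight_sum_le:
  assumes b: "\<beta> > 0" and n: "n \<ge> 1"
    and C: "\<And>J D. finite (J :: (vertex \<Rightarrow> int) set) \<Longrightarrow>
      (\<Sum>i\<in>J. \<Sum>j\<in>J. \<Prod>e\<in>edge_index n. exp (- ((real_of_int (D i e - D j e) - s e)\<^sup>2 / (2 * \<beta>))))
      \<le> r * (\<Sum>i\<in>J. \<Sum>j\<in>J. \<Prod>e\<in>edge_index n. exp (- ((real_of_int (D i e - D j e))\<^sup>2 / (2 * \<beta>))))"
    and r: "r > 0"
  shows "tilted_weight n \<beta> s summable_on configs n"
    and "infsum (tilted_weight n \<beta> s) (configs n) \<le> r * infsum (tilted_weight n \<beta> (\<lambda>_. 0)) (configs n)"
proof -
  let ?w = "tilted_weight n \<beta> s" and ?u = "tilted_weight n \<beta> (\<lambda>_. 0)"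
  have sm0: "?u summable_on configs n"
    using summable_ivgff[of "1 / \<beta>" n] b tilted_weight_zero[OF _ n, of _ \<beta>]
    by (simp cong: summable_on_cong)
  define T0 where "T0 = infsum ?u (configs n)"
  define m where "m = card (grid_box n)"
  define box where "box R = PiE_dflt (Site ` grid_box n) (0::int) (\<lambda>_. {- int R..int R})" for R
  have box_fin: "finite (box R)" for R unfolding box_def by (intro finite_PiE_dflt) auto
  have box_card: "real (card (box R)) = (2 * real R + 1) ^ m" for R
  proof -
    have "card (box R) = (\<Prod>x\<in>Site ` grid_box n. card {- int R..int R})"
      unfolding box_def by (rule card_PiE_dflt) auto
    also have "\<dots> = (2 * R + 1) ^ m"
      by (simp add: m_def card_image inj_on_def nat_add_distrib nat_mult_distrib)
    finally show ?thesis by (simp add: add.commute)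
  qed
  have configs_eq: "configs n = {\<Psi>. \<forall>v. v \<notin> Site ` grid_box n \<longrightarrow> \<Psi> v = 0}"
  proof -
    have "Infty \<notin> Site ` grid_box n" by auto
    then show ?thesis unfolding configs_def verts_def by auto metis
  qed
  have box_sub: "box R \<subseteq> configs n" for R
    unfolding box_def configs_eq PiE_dflt_def by auto
  \<comment> \<open>The weights are positive, so a bound on all finite subsums yields both
    summability and the bound on the sum.\<close>
  have finbd: "sum ?w F \<le> r * T0" if F: "finite F" "F \<subseteq> configs n" for F
  proof -
    define q where "q = nat (\<Sum>\<Psi>\<in>F. \<Sum>p\<in>grid_box n. \<bar>\<Psi> (Site p)\<bar>)"
    have Fq: "\<bar>\<Psi> (Site p)\<bar> \<le> int q" if "\<Psi> \<in> F" "p \<in> grid_box n" for \<Psi> p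
    proof -
      have "\<bar>\<Psi> (Site p)\<bar> \<le> (\<Sum>p\<in>grid_box n. \<bar>\<Psi> (Site p)\<bar>)"
        using that by (intro member_le_sum) auto
      also have "\<dots> \<le> (\<Sum>\<Psi>\<in>F. \<Sum>p\<in>grid_box n. \<bar>\<Psi> (Site p)\<bar>)"
        using that F by (intro member_le_sum[of \<Psi> F "\<lambda>\<Psi>. \<Sum>p\<in>grid_box n. \<bar>\<Psi> (Site p)\<bar>"] sum_nonneg) auto
      finally show ?thesis unfolding q_def by linarith
    qed
    have shift: "(\<lambda>x. \<Phi> x + \<Psi> x) \<in> box (k + q)" if "\<Phi> \<in> box k" "\<Psi> \<in> F" for \<Phi> \<Psi> k
    proof -
      have "- int (k + q) \<le> \<Phi> (Site p) + \<Psi> (Site p) \<and> \<Phi> (Site p) + \<Psi> (Site p) \<le> int (k + q)"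
        if p: "p \<in> grid_box n" for p
      proof -
        have "- int k \<le> \<Phi> (Site p)" "\<Phi> (Site p) \<le> int k"
          using \<open>\<Phi> \<in> box k\<close> p unfolding box_def PiE_dflt_def by auto
        then show ?thesis using Fq[OF \<open>\<Psi> \<in> F\<close> p] by linarith
      qed
      moreover have "\<Phi> v + \<Psi> v = 0" if v: "v \<notin> Site ` grid_box n" for v
      proof -
        have "\<Phi> \<in> configs n" "\<Psi> \<in> configs n"
          using \<open>\<Phi> \<in> box k\<close> \<open>\<Psi> \<in> F\<close> F(2) box_sub[of k] by blast+
        then show ?thesis using v unfolding configs_eq by simp
      qed
      ultimately show ?thesis unfolding box_def PiE_dflt_def by auto
    qed
    \<comment> \<open>For every \<open>\<Phi>\<close> in \<open>box k\<close> the translate of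
      \<open>F\<close> by \<open>\<Phi>\<close> lies in \<open>J = box (k + q)\<close>, so the pair
      sum over \<open>J\<close> contains at least \<open>card (box k)\<close> copies of
      \<open>sum ?w F\<close>. For the unshifted weight each of the \<open>card J\<close> rows is at
      most \<open>T0\<close>.\<close>
    have key: "sum ?w F \<le> r * T0 * ((2 * real (k + q) + 1) / (2 * real k + 1)) ^ m" for k
    proof -
      define J where "J = box (k + q)"
      have J: "finite J" by (simp add: J_def box_fin)
      have kJ: "box k \<subseteq> J" unfolding J_def box_def PiE_dflt_def by force
      have w: "?w (\<lambda>x. \<Psi> x - \<Phi> x) = (\<Prod>e\<in>edge_index n. exp (- ((real_of_int (edge_diff \<Psi> e - edge_diff \<Phi> e) - s e)\<^sup>2 / (2 * \<beta>))))"
        "?u (\<lambda>x. \<Psi> x - \<Phi> x) = (\<Prod>e\<in>edge_index n. exp (- ((real_of_int (edge_diff \<Psi> e - edge_diff \<Phi> e))\<^sup>2 / (2 * \<beta>))))" for \<Psi> \<Phi>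
        by (simp_all add: tilted_weight_def edge_diff_diff)
      have "real (card (box k)) * sum ?w F = (\<Sum>\<Phi>\<in>box k. sum ?w F)" by simp
      also have "\<dots> \<le> (\<Sum>\<Phi>\<in>box k. \<Sum>\<Psi>\<in>J. ?w (\<lambda>x. \<Psi> x - \<Phi> x))"
      proof (rule sum_mono)
        fix \<Phi> assume \<Phi>: "\<Phi> \<in> box k"
        have inj: "inj_on (\<lambda>\<Psi> x. \<Phi> x + \<Psi> x) F" by (auto simp: inj_on_def fun_eq_iff)
        have "sum ?w F = (\<Sum>\<Psi>\<in>(\<lambda>\<Psi> x. \<Phi> x + \<Psi> x) ` F. ?w (\<lambda>x. \<Psi> x - \<Phi> x))"
          by (simp add: sum.reindex[OF inj])
        also have "\<dots> \<le> (\<Sum>\<Psi>\<in>J. ?w (\<lambda>x. \<Psi> x - \<Phi> x))"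
          using shift[OF \<Phi>] by (intro sum_mono2 J) (auto simp: J_def less_imp_le[OF tilted_weight_pos])
        finally show "sum ?w F \<le> (\<Sum>\<Psi>\<in>J. ?w (\<lambda>x. \<Psi> x - \<Phi> x))" .
      qed
      also have "\<dots> \<le> (\<Sum>\<Phi>\<in>J. \<Sum>\<Psi>\<in>J. ?w (\<lambda>x. \<Psi> x - \<Phi> x))"
        using kJ by (intro sum_mono2 J sum_nonneg less_imp_le[OF tilted_weight_pos])
      also have "\<dots> = (\<Sum>\<Psi>\<in>J. \<Sum>\<Phi>\<in>J. ?w (\<lambda>x. \<Psi> x - \<Phi> x))" by (rule sum.swap)
      also have "\<dots> \<le> r * (\<Sum>\<Psi>\<in>J. \<Sum>\<Phi>\<in>J. ?u (\<lambda>x. \<Psi> x - \<Phi> x))"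
        unfolding w by (rule C[OF J])
      also have "(\<Sum>\<Psi>\<in>J. \<Sum>\<Phi>\<in>J. ?u (\<lambda>x. \<Psi> x - \<Phi> x)) \<le> (\<Sum>\<Psi>\<in>J. T0)"
      proof (rule sum_mono)
        fix \<Psi> assume \<Psi>: "\<Psi> \<in> J"
        have inj: "inj_on (\<lambda>\<Phi> x. \<Psi> x - \<Phi> x) J" by (auto simp: inj_on_def fun_eq_iff)
        have "J \<subseteq> configs n" unfolding J_def by (rule box_sub)
        then have "(\<lambda>x. \<Psi> x - \<Phi> x) \<in> configs n" if "\<Phi> \<in> J" for \<Phi>
        proof -
          have "\<Psi> \<in> configs n" "\<Phi> \<in> configs n"
            using that \<Psi> \<open>J \<subseteq> configs n\<close> by blast+
          then show ?thesis unfolding configs_eq by simp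
        qed
        then have "(\<lambda>\<Phi> x. \<Psi> x - \<Phi> x) ` J \<subseteq> configs n" by blast
        then have "sum ?u ((\<lambda>\<Phi> x. \<Psi> x - \<Phi> x) ` J) \<le> T0"
          unfolding T0_def using J by (intro finite_sum_le_infsum sm0 less_imp_le[OF tilted_weight_pos]) auto
        then show "(\<Sum>\<Phi>\<in>J. ?u (\<lambda>x. \<Psi> x - \<Phi> x)) \<le> T0"
          by (simp add: sum.reindex[OF inj])
      qed
      also have "(\<Sum>\<Psi>\<in>J. T0) = (2 * real (k + q) + 1) ^ m * T0"
        unfolding J_def by (simp add: box_card[unfolded of_nat_add] del: of_nat_add)
      finally have "(2 * real k + 1) ^ m * sum ?w F \<le> r * ((2 * real (k + q) + 1) ^ m * T0)"
        using r by (simp add: box_card)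
      moreover have "(2 * real k + 1) ^ m > 0" by simp
      ultimately show ?thesis by (simp add: power_divide pos_le_divide_eq mult_ac)
    qed
    \<comment> \<open>With \<open>q\<close> and \<open>m\<close> fixed, enlarging the boxes by
      \<open>q\<close> becomes negligible in the limit.\<close>
    have "(\<lambda>k. (2 * real (k + q) + 1) / (2 * real k + 1)) \<longlonglongrightarrow> 1"
      unfolding of_nat_add by real_asymp
    from tendsto_mult[OF tendsto_const[of "r * T0"] tendsto_power[OF this, of m]]
    have "(\<lambda>k. r * T0 * ((2 * real (k + q) + 1) / (2 * real k + 1)) ^ m) \<longlonglongrightarrow> r * T0" by simp
    then show ?thesis by (rule LIMSEQ_le_const) (use key in auto)
  qed
  show sm: "?w summable_on configs n"
    by (rule nonneg_bdd_above_summable_on)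
       (use finbd in \<open>auto intro!: bdd_aboveI2[where M = "r * T0"] less_imp_le[OF tilted_weight_pos]\<close>)
  show "infsum ?w (configs n) \<le> r * infsum ?u (configs n)"
    unfolding T0_def[symmetric] by (rule infsum_le_finite_sums[OF sm]) (use finbd in auto)
qed

lemma prob_site_gt_le:
  assumes b: "\<beta> > 0" and n: "n \<ge> 1" and v: "v \<in> grid_box n" and t: "t \<ge> 0"
    and s: "s = (\<lambda>e. \<beta> * t * angle_flow v e)"
    and sm: "tilted_weight n \<beta> s summable_on configs n"
    and le: "infsum (tilted_weight n \<beta> s) (configs n) \<le> r * infsum (tilted_weight n \<beta> (\<lambda>_. 0)) (configs n)"
  shows "measure_pmf.prob (ivgff n (1 / \<beta>)) {\<Psi>. real_of_int (\<Psi> (Site v)) > c}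
    \<le> exp (- t * c + \<beta> * t\<^sup>2 / 2 * (\<Sum>e\<in>edge_index n. (angle_flow v e)\<^sup>2)) * r"
proof -
  let ?w = "tilted_weight n \<beta> s" and ?u = "tilted_weight n \<beta> (\<lambda>_. 0)"
  define Z where "Z = infsum ?u (configs n)"
  define S where "S = (\<Sum>e\<in>edge_index n. (angle_flow v e)\<^sup>2)"
  define K where "K = exp (- t * c + \<beta> * t\<^sup>2 / 2 * S)"
  define A where "A = {\<Psi>. real_of_int (\<Psi> (Site v)) > c}"
  have Zeq: "Z = (\<Sum>\<^sub>\<infinity>\<Phi>\<in>configs n. exp (- (1 / \<beta> / 2 * dirichlet_energy n \<Phi>)))"
    unfolding Z_def by (intro infsum_cong tilted_weight_zero n)
  have sm0: "?u summable_on configs n"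
    using summable_ivgff[of "1 / \<beta>" n] b tilted_weight_zero[OF _ n, of _ \<beta>]
    by (simp cong: summable_on_cong)
  have Z: "Z > 0"
  proof -
    have "(\<lambda>_. 0) \<in> configs n" by (simp add: configs_def)
    then have "sum ?u {\<lambda>_. 0} \<le> Z"
      unfolding Z_def by (intro finite_sum_le_infsum sm0 less_imp_le[OF tilted_weight_pos]) auto
    then show ?thesis using tilted_weight_pos[of n \<beta> "\<lambda>_. 0" "\<lambda>_. 0"] by simp
  qed
  \<comment> \<open>With \<open>s\<close> proportional to the flow, the cross terms of the squares
    sum to \<open>t\<close> times the height at \<open>v\<close>, and the remaining terms do not
    depend on \<open>\<Psi>\<close>.\<close>
  have tilt: "?w \<Psi> = ?u \<Psi> * exp (t * real_of_int (\<Psi> (Site v)) - \<beta> * t\<^sup>2 / 2 * S)" if \<Psi>: "\<Psi> \<in> configs n" for \<Psi>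
  proof -
    have "- ((real_of_int (edge_diff \<Psi> e) - s e)\<^sup>2 / (2 * \<beta>)) = - ((real_of_int (edge_diff \<Psi> e) - 0)\<^sup>2 / (2 * \<beta>))
        + (t * (angle_flow v e * real_of_int (edge_diff \<Psi> e)) - \<beta> * t\<^sup>2 / 2 * (angle_flow v e)\<^sup>2)" for e
      using b unfolding s by (simp add: field_simps power2_eq_square)
    then have "exp (- ((real_of_int (edge_diff \<Psi> e) - s e)\<^sup>2 / (2 * \<beta>))) = exp (- ((real_of_int (edge_diff \<Psi> e) - 0)\<^sup>2 / (2 * \<beta>)))
        * exp (t * (angle_flow v e * real_of_int (edge_diff \<Psi> e)) - \<beta> * t\<^sup>2 / 2 * (angle_flow v e)\<^sup>2)" for e
      by (metis exp_add)
    then have "tilted_weight n \<beta> s \<Psi> = (\<Prod>e\<in>edge_index n. exp (- ((real_of_int (edge_diff \<Psi> e) - 0)\<^sup>2 / (2 * \<beta>)))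
        * exp (t * (angle_flow v e * real_of_int (edge_diff \<Psi> e)) - \<beta> * t\<^sup>2 / 2 * (angle_flow v e)\<^sup>2))"
      unfolding tilted_weight_def by (intro prod.cong refl)
    also have "\<dots> = ?u \<Psi> * exp (\<Sum>e\<in>edge_index n. t * (angle_flow v e * real_of_int (edge_diff \<Psi> e)) - \<beta> * t\<^sup>2 / 2 * (angle_flow v e)\<^sup>2)"
      unfolding tilted_weight_def prod.distrib exp_sum[OF finite_edge_index] ..
    also have "(\<Sum>e\<in>edge_index n. t * (angle_flow v e * real_of_int (edge_diff \<Psi> e)) - \<beta> * t\<^sup>2 / 2 * (angle_flow v e)\<^sup>2)
      = t * real_of_int (\<Psi> (Site v)) - \<beta> * t\<^sup>2 / 2 * S"
      unfolding sum_subtractf sum_distrib_left[symmetric] angle_flow_represents[OF \<Psi> v] S_def ..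
    finally show ?thesis .
  qed
  have ab: "Infinite_Set_Sum.abs_summable_on (pmf (ivgff n (1 / \<beta>))) A"
    by (rule pmf_abs_summable)
  then have smA: "pmf (ivgff n (1 / \<beta>)) summable_on A"
    unfolding abs_summable_equivalent[symmetric] by (rule abs_summable_summable)
  have "measure_pmf.prob (ivgff n (1 / \<beta>)) A = (\<Sum>\<^sub>\<infinity>\<Psi>\<in>A. pmf (ivgff n (1 / \<beta>)) \<Psi>)"
    unfolding measure_pmf_conv_infsetsum by (rule infsetsum_infsum[OF ab])
  also have "\<dots> \<le> (\<Sum>\<^sub>\<infinity>\<Psi>\<in>configs n. K / Z * ?w \<Psi>)"
  proof (rule infsum_mono_neutral[OF smA summable_on_cmult_right[OF sm]])
    fix \<Psi> assume "\<Psi> \<in> A \<inter> configs n"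
    then have \<Psi>: "\<Psi> \<in> configs n" and c: "real_of_int (\<Psi> (Site v)) > c" by (auto simp: A_def)
    have "t * c \<le> t * real_of_int (\<Psi> (Site v))" using t c by (intro mult_left_mono) auto
    then have "1 \<le> exp (- t * c + t * real_of_int (\<Psi> (Site v)))" by simp
    also have "\<dots> = K * exp (t * real_of_int (\<Psi> (Site v)) - \<beta> * t\<^sup>2 / 2 * S)"
      by (simp add: K_def exp_add[symmetric])
    finally have "?u \<Psi> * 1 \<le> ?u \<Psi> * (K * exp (t * real_of_int (\<Psi> (Site v)) - \<beta> * t\<^sup>2 / 2 * S))"
      by (intro mult_left_mono less_imp_le[OF tilted_weight_pos])
    then have "?u \<Psi> \<le> K * ?w \<Psi>" unfolding tilt[OF \<Psi>] by (simp add: mult_ac)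
    then have "?u \<Psi> / Z \<le> K * ?w \<Psi> / Z" using Z by (intro divide_right_mono) auto
    moreover have "pmf (ivgff n (1 / \<beta>)) \<Psi> = ?u \<Psi> / Z"
      using pmf_ivgff[of "1 / \<beta>" n \<Psi>] b \<Psi> tilted_weight_zero[OF \<Psi> n, of \<beta>] by (simp add: Zeq)
    ultimately show "pmf (ivgff n (1 / \<beta>)) \<Psi> \<le> K / Z * ?w \<Psi>" by simp
  next
    fix \<Psi> assume "\<Psi> \<in> A - configs n"
    then show "pmf (ivgff n (1 / \<beta>)) \<Psi> \<le> 0" using pmf_ivgff[of "1 / \<beta>" n \<Psi>] b by simp
  next
    fix \<Psi> show "0 \<le> K / Z * ?w \<Psi>"
      using Z less_imp_le[OF tilted_weight_pos] by (intro mult_nonneg_nonneg) (auto simp: K_def)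
  qed
  also have "\<dots> = K / Z * infsum ?w (configs n)" by (rule infsum_cmult_right')
  also have "\<dots> \<le> K / Z * (r * Z)"
    using Z le by (intro mult_left_mono) (auto simp: K_def Z_def)
  also have "\<dots> = K * r" using Z by simp
  finally show ?thesis by (simp add: A_def K_def S_def)
qed

section \<open>The size of the error function and the final exponent\<close>

lemma error_M_eq: "error_M \<beta> = (2 * pi)\<^sup>2 * \<beta> * min_var ((2 * pi)\<^sup>2 * \<beta>)"
  by (simp add: error_M_def min_var_def)

lemma error_M_pos: "\<beta> > 0 \<Longrightarrow> error_M \<beta> > 0"
  unfolding error_M_eq by (intro mult_pos_pos min_var_pos) auto

text \<open>If M exceeded 1, the rate would fall below the Gaussian weight to second order as
  \<open>s\<close> tends to 0. The bound makes 1 - M nonnegative, so that an upper bound for the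
  energy of the flow may be inserted.\<close>

lemma error_M_le_1:
  assumes b: "\<beta> > 0" and C: "C > 0"
    and le: "\<And>s. exp (- (s\<^sup>2 / (2 * \<beta>))) \<le> theta_rate \<beta> C s"
  shows "error_M \<beta> \<le> 1"
proof (rule ccontr)
  assume "\<not> error_M \<beta> \<le> 1"
  then have M: "error_M \<beta> > 1" by simp
  define d where "d = (error_M \<beta> - 1) / (2 * \<beta>)"
  have d: "d > 0" using M b by (simp add: d_def)
  define D where "D = C * (2 * pi) ^ 3"
  have D: "D > 0" using C by (simp add: D_def)
  \<comment> \<open>Chosen so that the cubic term is exactly half of the quadratic gap
    \<open>d * s\<^sup>2\<close>.\<close>
  define s where "s = d / (2 * D)"
  have s: "s > 0" using d D by (simp add: s_def)
  have "- (s\<^sup>2 / (2 * \<beta>)) \<le> - (min_var ((2 * pi)\<^sup>2 * \<beta>) * (2 * pi * s)\<^sup>2 / 2) + C * \<bar>2 * pi * s\<bar> ^ 3"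
    using le[of s] unfolding theta_rate_def by (simp only: exp_le_cancel_iff)
  also have "\<bar>2 * pi * s\<bar> = 2 * pi * s" using s by simp
  also have "min_var ((2 * pi)\<^sup>2 * \<beta>) * (2 * pi * s)\<^sup>2 / 2 = error_M \<beta> * s\<^sup>2 / (2 * \<beta>)"
    using b by (simp add: error_M_eq power_mult_distrib)
  finally have "error_M \<beta> * s\<^sup>2 / (2 * \<beta>) - s\<^sup>2 / (2 * \<beta>) \<le> D * s ^ 3"
    by (simp add: D_def power_mult_distrib)
  moreover have "error_M \<beta> * s\<^sup>2 / (2 * \<beta>) - s\<^sup>2 / (2 * \<beta>) = d * s\<^sup>2"
    by (simp add: d_def diff_divide_distrib left_diff_distrib)
  moreover have "D * s ^ 3 = d / 2 * s\<^sup>2"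
  proof -
    have "D * s ^ 3 = (D * s) * s\<^sup>2" by (simp add: power3_eq_cube power2_eq_square)
    also have "D * s = d / 2" using D by (simp add: s_def)
    finally show ?thesis .
  qed
  moreover have "d / 2 * s\<^sup>2 < d * s\<^sup>2" using d s by simp
  ultimately show False by linarith
qed

text \<open>The quadratic part is \<open>error_M \<beta>\<close> times the Gaussian exponent from
  completing the square, with the opposite sign; adding the two produces the factor 1 - M.\<close>

lemma prod_theta_rate_flow:
  assumes b: "\<beta> > 0" and t: "t \<ge> 0"
  shows "(\<Prod>e\<in>edge_index n. theta_rate \<beta> C (\<beta> * t * angle_flow v e))
    = exp (- (error_M \<beta> * (\<beta> * t\<^sup>2 / 2) * (\<Sum>e\<in>edge_index n. (angle_flow v e)\<^sup>2))
       + C * (2 * pi * \<beta> * t) ^ 3 * (\<Sum>e\<in>edge_index n. \<bar>angle_flow v e\<bar> ^ 3))"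
proof -
  have "theta_rate \<beta> C (\<beta> * t * angle_flow v e)
    = exp (- (error_M \<beta> * (\<beta> * t\<^sup>2 / 2) * (angle_flow v e)\<^sup>2)
       + C * (2 * pi * \<beta> * t) ^ 3 * \<bar>angle_flow v e\<bar> ^ 3)" for e
  proof -
    have "min_var ((2 * pi)\<^sup>2 * \<beta>) * (2 * pi * (\<beta> * t * angle_flow v e))\<^sup>2 / 2
      = error_M \<beta> * (\<beta> * t\<^sup>2 / 2) * (angle_flow v e)\<^sup>2"
      by (simp add: error_M_eq power_mult_distrib power2_eq_square mult_ac)
    moreover have "\<bar>2 * pi * (\<beta> * t * angle_flow v e)\<bar> = 2 * pi * \<beta> * t * \<bar>angle_flow v e\<bar>"
      using b t by (simp add: abs_mult)
    ultimately show ?thesis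
      unfolding theta_rate_def by (simp only: power_mult_distrib mult.assoc)
  qed
  then show ?thesis
    by (simp add: exp_sum[symmetric] sum.distrib sum_negf sum_subtractf sum_distrib_left)
qed

text \<open>\<open>t\<close> minimises
  \<open>- t * c + \<beta> * t\<^sup>2 / 2 * K / (2 * pi)\<close>, and \<open>c\<close> is chosen so
  that the minimum is -2. Since 1 - M = K - M/2, the true variance factor improves this by
  \<open>M / K\<close>.\<close>

lemma site_tail_exponent:
  assumes b: "\<beta> > 0" and M: "0 < M" "M \<le> (1::real)"
  defines "K \<equiv> 1 - M / 2"
  defines "c \<equiv> sqrt (K * 2 * \<beta> / pi)"
  defines "t \<equiv> 2 * pi * c / (\<beta> * K)"
  shows "- t * (c * L) + \<beta> * t\<^sup>2 / 2 * ((1 - M) * ((3 + (ln 2 + L)) / (2 * pi)))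
    \<le> - (2 + M / K) * L + 2 * (3 + ln 2)"
proof -
  have K: "K > 0" using M by (simp add: K_def)
  have c2: "c\<^sup>2 = K * 2 * \<beta> / pi" using K b by (simp add: c_def)
  have tc: "t * c = 4"
  proof -
    have "t * c = 2 * pi * c\<^sup>2 / (\<beta> * K)" by (simp add: t_def power2_eq_square)
    then show ?thesis using K b by (simp add: c2)
  qed
  have "t\<^sup>2 = (2 * pi)\<^sup>2 * c\<^sup>2 / (\<beta> * K)\<^sup>2" by (simp add: t_def power_divide power_mult_distrib)
  also have "\<dots> = 8 * pi / (\<beta> * K)" unfolding c2 using K b by (simp add: field_simps power2_eq_square)
  finally have t2: "t\<^sup>2 = 8 * pi / (\<beta> * K)" .
  have "\<beta> * t\<^sup>2 / 2 = 4 * pi / K" using b by (simp add: t2)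
  then have e: "\<beta> * t\<^sup>2 / 2 * ((1 - M) * ((3 + (ln 2 + L)) / (2 * pi))) = 2 * ((1 - M) / K) * (3 + ln 2 + L)"
    by (simp add: add_ac)
  have r: "(1 - M) / K = 1 - M / (2 * K)"
  proof -
    have "1 - M = K - M / 2" by (simp add: K_def)
    then have "(1 - M) / K = (K - M / 2) / K" by simp
    also have "\<dots> = 1 - M / (2 * K)" using K by (simp add: diff_divide_distrib)
    finally show ?thesis .
  qed
  have "- t * (c * L) + \<beta> * t\<^sup>2 / 2 * ((1 - M) * ((3 + (ln 2 + L)) / (2 * pi)))
    = - 4 * L + 2 * (1 - M / (2 * K)) * (3 + ln 2 + L)"
    unfolding e r using tc by (simp add: mult.assoc[symmetric])
  also have "\<dots> = - (2 + M / K) * L + 2 * (3 + ln 2) - M / K * (3 + ln 2)"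
    by (simp add: algebra_simps add_divide_distrib)
  also have "\<dots> \<le> - (2 + M / K) * L + 2 * (3 + ln 2)"
    using K M by simp
  finally show ?thesis .
qed

lemma prob_max_gt_le:
  assumes b: "b > 0" and \<lambda>: "l \<ge> 0"
    and site: "\<And>v. v \<in> grid_box n \<Longrightarrow> measure_pmf.prob (ivgff n b) {\<Psi>. real_of_int (\<Psi> (Site v)) > l} \<le> P"
  shows "1 - measure_pmf.prob (ivgff n b) {\<Psi>. real_of_int (Max (\<Psi> ` verts n)) \<le> l} \<le> (2 * real n + 1)\<^sup>2 * P"
proof -
  let ?p = "ivgff n b"
  define G where "G = {\<Psi> :: vertex \<Rightarrow> int. real_of_int (Max (\<Psi> ` verts n)) \<le> l}"
  have fin: "finite (verts n)" by (simp add: verts_def)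
  have supp: "set_pmf ?p \<subseteq> configs n"
    using pmf_ivgff[OF b] by (force simp: set_pmf_iff split: if_splits)
  have sub: "(- G) \<inter> set_pmf ?p \<subseteq> (\<Union>v\<in>grid_box n. {\<Psi>. real_of_int (\<Psi> (Site v)) > l})"
  proof
    fix \<Psi> assume "\<Psi> \<in> (- G) \<inter> set_pmf ?p"
    then have \<Psi>: "\<Psi> \<in> configs n" and gt: "real_of_int (Max (\<Psi> ` verts n)) > l"
      using supp by (auto simp: G_def)
    have "Max (\<Psi> ` verts n) \<in> \<Psi> ` verts n" using fin by (intro Max_in) (auto simp: verts_def)
    then obtain u where u: "u \<in> verts n" "real_of_int (\<Psi> u) > l" using gt by auto
    \<comment> \<open>The maximum also ranges over \<open>Infty\<close>, where the height is 0; a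
      nonnegative level excludes it.\<close>
    moreover have "u \<noteq> Infty" using u(2) \<Psi> \<lambda> by (auto simp: configs_def)
    ultimately show "\<Psi> \<in> (\<Union>v\<in>grid_box n. {\<Psi>. real_of_int (\<Psi> (Site v)) > l})"
      by (auto simp: verts_def)
  qed
  have "1 - measure_pmf.prob ?p G = measure_pmf.prob ?p (- G)"
    by (subst Compl_eq_Diff_UNIV, subst measure_pmf.prob_compl[of G ?p, simplified]) auto
  also have "\<dots> = measure_pmf.prob ?p ((- G) \<inter> set_pmf ?p)" by (simp add: measure_Int_set_pmf)
  also have "\<dots> \<le> measure_pmf.prob ?p (\<Union>v\<in>grid_box n. {\<Psi>. real_of_int (\<Psi> (Site v)) > l})"
    by (rule measure_pmf.finite_measure_mono[OF sub]) simp
  also have "\<dots> \<le> (\<Sum>v\<in>grid_box n. measure_pmf.prob ?p {\<Psi>. real_of_int (\<Psi> (Site v)) > l})"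
    by (rule measure_pmf.finite_measure_subadditive_finite) auto
  also have "\<dots> \<le> (\<Sum>v\<in>grid_box n. P)" by (intro sum_mono site)
  also have "\<dots> = (2 * real n + 1)\<^sup>2 * P"
    by (simp add: grid_box_def card_cartesian_product power2_eq_square)
  finally show ?thesis by (simp add: G_def)
qed

theorem theorem1p9:
  fixes \<beta> :: real
  assumes "\<beta> > 0"
  shows "(\<lambda>n. measure_pmf.prob (ivgff n (1 / \<beta>))
            {\<Psi>. real_of_int (Max (\<Psi> ` verts n)) \<le> sqrt ((1 - error_M \<beta> / 2) * 2 * \<beta> / pi) * ln (real n)})
         \<longlonglongrightarrow> 1"
proof -
  note b = assms
  obtain C where C: "C > 0"
    "\<And>s. exp (- (s\<^sup>2 / (2 * \<beta>))) \<le> theta_rate \<beta> C s"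
    "\<And>(I :: (int \<times> int + int \<times> int) set) (J :: (vertex \<Rightarrow> int) set) D s. finite I \<Longrightarrow> finite J \<Longrightarrow>
      (\<Sum>i\<in>J. \<Sum>j\<in>J. \<Prod>e\<in>I. exp (- ((real_of_int (D i e - D j e) - s e)\<^sup>2 / (2 * \<beta>))))
      \<le> (\<Prod>e\<in>I. theta_rate \<beta> C (s e)) *
        (\<Sum>i\<in>J. \<Sum>j\<in>J. \<Prod>e\<in>I. exp (- ((real_of_int (D i e - D j e))\<^sup>2 / (2 * \<beta>))))"
    using gaussian_kernel_domination[OF b] by blast
  define M where "M = error_M \<beta>"
  have M: "0 < M" "M \<le> 1"
    using error_M_pos[OF b] error_M_le_1[OF b C(1,2)] by (auto simp: M_def)
  define K where "K = 1 - M / 2"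
  have K: "K > 0" using M by (simp add: K_def)
  define c where "c = sqrt (K * 2 * \<beta> / pi)"
  define t where "t = 2 * pi * c / (\<beta> * K)"
  have c: "c > 0" using K b by (simp add: c_def)
  have t: "t \<ge> 0" using c K b by (simp add: t_def)
  \<comment> \<open>Everything that stays bounded in \<open>n\<close> and \<open>v\<close>: the
    additive constants of the energy bound and the cubic corrections of all edges.\<close>
  define E where "E = 2 * (3 + ln 2) + C * (2 * pi * \<beta> * t) ^ 3 * (10 * pi / (2 * pi) ^ 3)"
  have site: "measure_pmf.prob (ivgff n (1 / \<beta>)) {\<Psi>. real_of_int (\<Psi> (Site v)) > c * ln (real n)}
      \<le> exp (- (2 + M / K) * ln (real n) + E)"
    if n: "n \<ge> 1" and v: "v \<in> grid_box n" for n v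
  proof -
    define s where "s = (\<lambda>e. \<beta> * t * angle_flow v e)"
    define r where "r = (\<Prod>e\<in>edge_index n. theta_rate \<beta> C (s e))"
    define S where "S = (\<Sum>e\<in>edge_index n. (angle_flow v e)\<^sup>2)"
    define T where "T = (\<Sum>e\<in>edge_index n. \<bar>angle_flow v e\<bar> ^ 3)"
    define L where "L = ln (real n)"
    have r: "r > 0" unfolding r_def theta_rate_def by (intro prod_pos) auto
    have r_eq: "r = exp (- (M * (\<beta> * t\<^sup>2 / 2) * S) + C * (2 * pi * \<beta> * t) ^ 3 * T)"
      unfolding r_def s_def M_def S_def T_def by (rule prod_theta_rate_flow[OF b t])
    note dom = tilted_weight_sum_le[OF b n C(3)[OF finite_edge_index] r[unfolded r_def], folded r_def]
    have "measure_pmf.prob (ivgff n (1 / \<beta>)) {\<Psi>. real_of_int (\<Psi> (Site v)) > c * L}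
      \<le> exp (- t * (c * L) + \<beta> * t\<^sup>2 / 2 * S) * r"
      unfolding S_def by (rule prob_site_gt_le[OF b n v t s_def dom])
    also have "\<dots> = exp (- t * (c * L) + \<beta> * t\<^sup>2 / 2 * ((1 - M) * S) + C * (2 * pi * \<beta> * t) ^ 3 * T)"
    proof -
      have "A * S + (- (M * A * S) + X) = A * ((1 - M) * S) + X" for A X by (simp add: algebra_simps)
      then show ?thesis unfolding r_eq exp_add[symmetric] by (simp only: add.assoc)
    qed
    also have "\<dots> \<le> exp (- t * (c * L) + \<beta> * t\<^sup>2 / 2 * ((1 - M) * ((3 + (ln 2 + L)) / (2 * pi)))
        + C * (2 * pi * \<beta> * t) ^ 3 * (10 * pi / (2 * pi) ^ 3))"
    proof -
      have "S \<le> (3 + (ln 2 + L)) / (2 * pi)"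
        using sum_angle_flow_sq_le[OF v n] n by (simp add: S_def L_def ln_mult)
      moreover have "T \<le> 10 * pi / (2 * pi) ^ 3"
        unfolding T_def by (rule sum_angle_flow_cube_le[OF v])
      \<comment> \<open>Monotonicity in \<open>S\<close> uses that 1 - M is nonnegative.\<close>
      ultimately show ?thesis
        unfolding exp_le_cancel_iff using b t M C(1)
        by (intro add_mono order_refl mult_left_mono) auto
    qed
    also have "\<dots> \<le> exp (- (2 + M / K) * L + E)"
      using site_tail_exponent[OF b M, of L, folded K_def, folded c_def, folded t_def]
      unfolding exp_le_cancel_iff E_def by linarith
    finally show ?thesis by (simp add: L_def)
  qed
  let ?P = "\<lambda>n. measure_pmf.prob (ivgff n (1 / \<beta>)) {\<Psi>. real_of_int (Max (\<Psi> ` verts n)) \<le> c * ln (real n)}"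
  \<comment> \<open>The number of sites is at most \<open>(3 * real n)\<^sup>2\<close>, whence the
    9; its square cancels the \<open>n\<close> to the power -2 in the tail bound.\<close>
  have bound: "1 - ?P n \<le> 9 * exp E * real n powr (- (M / K))" if n: "n \<ge> 1" for n
  proof -
    have "1 - ?P n \<le> (2 * real n + 1)\<^sup>2 * exp (- (2 + M / K) * ln (real n) + E)"
      using b c n by (intro prob_max_gt_le site) auto
    also have "\<dots> \<le> (3 * real n)\<^sup>2 * exp (- (2 + M / K) * ln (real n) + E)"
      using n by (intro mult_right_mono power_mono) auto
    also have "exp (- (2 + M / K) * ln (real n) + E) = exp E * (real n powr (- (M / K)) / (real n)\<^sup>2)"
    proof -
      have "exp (- (2 + M / K) * ln (real n) + E) = exp E * (exp (- (M / K) * ln (real n)) * exp (- (2 * ln (real n))))"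
        unfolding exp_add[symmetric] by (simp add: algebra_simps)
      moreover have "exp (2 * ln (real n)) = (real n)\<^sup>2"
        using n by (simp add: exp_double)
      ultimately show ?thesis using n by (simp add: powr_def exp_minus divide_inverse)
    qed
    finally show ?thesis using n by (simp add: power_mult_distrib field_simps)
  qed
  have lim: "(\<lambda>n. 9 * exp E * real n powr (- (M / K))) \<longlonglongrightarrow> 9 * exp E * 0"
    using M K by (intro tendsto_intros tendsto_neg_powr filterlim_real_sequentially) auto
  have "(\<lambda>n. 1 - ?P n) \<longlonglongrightarrow> 0"
  proof (rule tendsto_sandwich[OF _ _ tendsto_const])
    show "\<forall>\<^sub>F n in sequentially. 0 \<le> 1 - ?P n" by (intro always_eventually) simp
    show "\<forall>\<^sub>F n in sequentially. 1 - ?P n \<le> 9 * exp E * real n powr (- (M / K))"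
      using eventually_ge_at_top[of 1] by eventually_elim (rule bound)
    show "(\<lambda>n. 9 * exp E * real n powr (- (M / K))) \<longlonglongrightarrow> 0" using lim by simp
  qed
  from tendsto_diff[OF tendsto_const[of 1] this] have "?P \<longlonglongrightarrow> 1" by simp
  then show ?thesis by (simp only: c_def K_def M_def)
qed

end
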